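(* Let $p=\alpha n^{-\omega}$ and $q=\beta n^{-\omega}$ for constants $\alpha>\beta>0$ and $\omega\in[0,1)$, with $\alpha,\beta\in(0,1)$ if $\omega=0$. Suppose that one of the following conditions holds: 1. $\omega=0$ and $$\beta>\max\left\{\frac{3-\alpha-\sqrt{(3-\alpha)^2-4\alpha}}{2},\ 2\alpha-1\right\}.$$ 2. $\omega\in(0,1)$ with $\frac1{1-\omega}\notin\mathbb N$ and $$\beta>\frac{1}{2\left\lceil\frac1{1-\omega}\right\rceil-1}\cdot\alpha.$$ 3. $\omega=\frac12$ and $$\beta>\max\left\{\frac{1-2e^{-\alpha^2}}{2-e^{-\alpha^2}},\ \frac{1}{3+2e^{-\alpha^2}}\right\}\cdot\alpha.$$ 4. $\omega\in(0,1)$ with $\frac1{1-\omega}\in\mathbb N\setminus\{2\}$ and $$\beta>\frac{1}{2\cdot\frac1{1-\omega}-1+2\exp\left(-\alpha^{\frac1{1-\omega}}\right)}\cdot\alpha.$$ Then, with high probability, the LP relaxation fails to recover the planted bisection in $G\sim\mathcal G_{n,p,q}$.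
   Context: $\mathcal G_{n,p,q}$ (stochastic block model), for $n$ even: a bisection $V_1,V_2$ (partition into two sets of size $n/2$) of $V=\{1,\dots,n\}$ is chosen uniformly at random, called the planted bisection; then, independently, each pair of nodes in the same part is joined by an edge with probability $p$, and each pair of nodes in different parts is joined by an edge with probability $q$. The parameters $\alpha,\beta,\omega$ are independent of $n$. "With high probability" means with probability tending to $1$ as $n\to\infty$ (along even $n$). The LP relaxation (metric relaxation of the minimum bisection problem) associated with a graph $G=(V,E)$ is the following linear program in $x\in\mathbb R^{\binom n2}$, with coordinates $x_{ij}$, $1\le i<j\le n$, and the convention $x_{ji}:=x_{ij}$: $$\min\ \sum_{1\le i<j\le n}a_{ij}x_{ij}$$ subject to $x_{ij}\le x_{ik}+x_{jk}$ for all distinct $i,j,k\in\{1,\dots,n\}$ with $i<j$; $x_{ij}+x_{ik}+x_{jk}\le 2$ for all $1\le i<j<k\le n$; and $\sum_{1\le i<j\le n}x_{ij}=n^2/4$. Here $a_{ij}=1$ if $\{i,j\}\in E$ and $a_{ij}=0$ otherwise. The cut vector corresponding to the planted bisection is $\bar x\in\{0,1\}^{\binom n2}$ with $\bar x_{ij}=0$ if $i,j$ are in the same set of the bisection and $\bar x_{ij}=1$ otherwise. The LP relaxation recovers the planted bisection if $\bar x$ is its unique optimal solution; otherwise it fails to recover it. *)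

theory Defs
  imports "HOL-Probability.Probability" "HOL-Library.Disjoint_Sets"
begin

text \<open>Unordered pairs of distinct nodes. Indexing the LP variables by these sets builds in the
  convention \<open>x\<^sub>j\<^sub>i = x\<^sub>i\<^sub>j\<close>.\<close>

definition node_pairs :: "nat \<Rightarrow> nat set set" where
  "node_pairs n = {e. e \<subseteq> {1..n} \<and> card e = 2}"

definition bisections :: "nat \<Rightarrow> nat set set set" where
  "bisections n = {P. partition_on {1..n} P \<and> card P = 2 \<and> (\<forall>A\<in>P. 2 * card A = n)}"

definition same_part :: "nat set set \<Rightarrow> nat set \<Rightarrow> bool" where
  "same_part P e \<longleftrightarrow> (\<exists>A\<in>P. e \<subseteq> A)"

definition sbm_edges :: "nat \<Rightarrow> real \<Rightarrow> real \<Rightarrow> nat set set \<Rightarrow> nat set set pmf" where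
  "sbm_edges n p q P =
     map_pmf (\<lambda>f. {e \<in> node_pairs n. f e})
       (Pi_pmf (node_pairs n) False (\<lambda>e. bernoulli_pmf (if same_part P e then p else q)))"

text \<open>The joint law of the planted bisection and the edge set. It is meaningful only for positive
  even \<open>n\<close>, since otherwise there is no bisection, and for \<open>p, q \<in> [0, 1]\<close>, since
  \<open>bernoulli_pmf\<close> truncates its parameter to that interval.\<close>

definition sbm :: "nat \<Rightarrow> real \<Rightarrow> real \<Rightarrow> (nat set set \<times> nat set set) pmf" where
  "sbm n p q =
     bind_pmf (pmf_of_set (bisections n)) (\<lambda>P. map_pmf (Pair P) (sbm_edges n p q P))"

text \<open>Points of the space of dimension \<open>n choose 2\<close> are functions that are \<open>undefined\<close> off
  \<open>node_pairs n\<close>; without this normalisation no optimal solution could be unique.\<close>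

definition lp_feasible :: "nat \<Rightarrow> (nat set \<Rightarrow> real) \<Rightarrow> bool" where
  "lp_feasible n x \<longleftrightarrow>
     x \<in> extensional (node_pairs n) \<and>
     (\<forall>i\<in>{1..n}. \<forall>j\<in>{1..n}. \<forall>k\<in>{1..n}. i < j \<and> k \<noteq> i \<and> k \<noteq> j \<longrightarrow>
        x {i, j} \<le> x {i, k} + x {j, k}) \<and>
     (\<forall>i\<in>{1..n}. \<forall>j\<in>{1..n}. \<forall>k\<in>{1..n}. i < j \<and> j < k \<longrightarrow>
        x {i, j} + x {i, k} + x {j, k} \<le> 2) \<and>
     (\<Sum>e\<in>node_pairs n. x e) = (real n)\<^sup>2 / 4"

definition lp_objective :: "nat \<Rightarrow> nat set set \<Rightarrow> (nat set \<Rightarrow> real) \<Rightarrow> real" where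
  "lp_objective n E x = (\<Sum>e\<in>node_pairs n. (if e \<in> E then 1 else 0) * x e)"

definition lp_optimal :: "nat \<Rightarrow> nat set set \<Rightarrow> (nat set \<Rightarrow> real) \<Rightarrow> bool" where
  "lp_optimal n E x \<longleftrightarrow> is_arg_min (lp_objective n E) (lp_feasible n) x"

definition cut_vector :: "nat \<Rightarrow> nat set set \<Rightarrow> nat set \<Rightarrow> real" where
  "cut_vector n P = (\<lambda>e\<in>node_pairs n. if same_part P e then 0 else 1)"

definition lp_recovers :: "nat \<Rightarrow> nat set set \<Rightarrow> nat set set \<Rightarrow> bool" where
  "lp_recovers n P E \<longleftrightarrow>
     lp_optimal n E (cut_vector n P) \<and> (\<forall>x. lp_optimal n E x \<longrightarrow> x = cut_vector n P)"

end

theory Submission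
  imports Defs "HOL-Real_Asymp.Real_Asymp"
begin

text \<open>
  Let \<open>\<rho>\<close> be the distance in the sampled graph, replaced by a real number \<open>T \<in> [d, d + 1]\<close> on pairs at distance
  more than \<open>d\<close>. This is still a metric, so \<open>c \<cdot> \<rho>\<close>, with \<open>c\<close> chosen such that the coordinates sum to
  \<open>n\<^sup>2 / 4\<close>, satisfies the triangle inequalities, and it satisfies the perimeter inequalities as soon as
  \<open>3 T c \<le> 2\<close>. Its cost is \<open>c\<close> times the number of edges, whereas the planted cut costs the number of
  edges across. Hence recovery fails once the average of \<open>\<rho>\<close> is large compared to \<open>T\<close> and to
  \<open>(\<alpha> + \<beta>) / \<beta>\<close>.

  For \<open>\<omega> > 0\<close> take \<open>d (1 - \<omega>) \<le> 1\<close>. Only a vanishing fraction of the pairs is at distance less than \<open>d\<close>.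
  If \<open>d (1 - \<omega>) = 1\<close>, there are at most \<open>n\<^sup>d\<^sup>-\<^sup>1\<close> paths of length \<open>d\<close> between two nodes, each present with
  probability at most \<open>\<alpha>\<^sup>d n\<^sup>1\<^sup>-\<^sup>d\<close>, so by Harris' inequality a pair is at distance more than \<open>d\<close> with
  probability at least \<open>exp (- \<alpha>\<^sup>d) - o(1)\<close>. The number of such pairs concentrates by Chebyshev's
  inequality: by the inequality of van den Berg and Kesten, the covariance of two connection events is
  at most the expected number of pairs of connecting paths that share an edge, and a union of two such
  paths is connected, so it has at most one vertex more than edges. For \<open>\<omega> = 0\<close> take \<open>d = 1\<close>.
  The choice of \<open>T\<close> between \<open>d\<close> and \<open>d + 1\<close> gives the maxima in the dense case and in the case
  \<open>\<omega> = 1/2\<close>.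
\<close>

section \<open>Random subsets\<close>

text \<open>The law of \<open>sbm_edges\<close> for an arbitrary ground set and an individual rate
  per element. This generality lets statements be proved by induction on the ground set.\<close>

definition random_subset :: "'a set \<Rightarrow> ('a \<Rightarrow> real) \<Rightarrow> 'a set pmf" where
  "random_subset A r = map_pmf (\<lambda>f. {e \<in> A. f e}) (Pi_pmf A False (\<lambda>e. bernoulli_pmf (r e)))"

lemma set_random_subset:
  assumes "finite A"
  shows "set_pmf (random_subset A r) \<subseteq> Pow A"
  by (auto simp: random_subset_def)

lemma finite_set_random_subset:
  assumes "finite A"
  shows "finite (set_pmf (random_subset A r))"
  using set_random_subset[OF assms] assms finite_Pow_iff finite_subset by metis

lemma integrable_random_subset [simp]:
  fixes f :: "'a set \<Rightarrow> real"
  assumes "finite A"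
  shows "integrable (measure_pmf (random_subset A r)) f"
  by (intro integrable_measure_pmf_finite finite_set_random_subset assms)

abbreviation expect :: "'a set \<Rightarrow> ('a \<Rightarrow> real) \<Rightarrow> ('a set \<Rightarrow> real) \<Rightarrow> real" where
  "expect A r f \<equiv> measure_pmf.expectation (random_subset A r) f"

text \<open>Written as the expectation of an indicator, so that linearity and the recursion
  \<open>expect_insert\<close> apply to probabilities directly.\<close>

abbreviation event_prob :: "'a set \<Rightarrow> ('a \<Rightarrow> real) \<Rightarrow> ('a set \<Rightarrow> bool) \<Rightarrow> real" where
  "event_prob A r \<phi> \<equiv> expect A r (\<lambda>E. of_bool (\<phi> E))"

lemma random_subset_insert:
  assumes "finite A" "x \<notin> A"
  shows "random_subset (insert x A) r =
    bind_pmf (bernoulli_pmf (r x)) (\<lambda>b. map_pmf (if b then insert x else id) (random_subset A r))"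
proof -
  have *: "{e. (e = x \<longrightarrow> b) \<and> (e \<noteq> x \<longrightarrow> e \<in> A \<and> f e)} = (if b then insert x else id) {e \<in> A. f e}" for f b
    using assms by auto
  show ?thesis
    unfolding random_subset_def Pi_pmf_insert[OF assms]
    by (simp add: pair_pmf_def map_pmf_def bind_assoc_pmf bind_return_pmf *)
qed

text \<open>Conditions on whether \<open>x\<close> is drawn. The inductions on the ground set run
  through this recursion; the range of \<open>r x\<close> matters because
  \<open>bernoulli_pmf\<close> truncates its parameter.\<close>

lemma expect_insert:
  assumes "finite A" "x \<notin> A" "r x \<in> {0..1}"
  shows "expect (insert x A) r f = r x * expect A r (\<lambda>E. f (insert x E)) + (1 - r x) * expect A r f"
proof -
  have "expect (insert x A) r f = (\<Sum>b\<in>UNIV. pmf (bernoulli_pmf (r x)) b *\<^sub>R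
      measure_pmf.expectation (map_pmf (if b then insert x else id) (random_subset A r)) f)"
    unfolding random_subset_insert[OF assms(1,2)]
    by (rule pmf_expectation_bind[where A = UNIV]) (auto simp: assms finite_set_random_subset)
  also have "\<dots> = r x * expect A r (\<lambda>E. f (insert x E)) + (1 - r x) * expect A r f"
    using assms by (simp add: UNIV_bool)
  finally show ?thesis .
qed

lemma expect_empty [simp]: "expect {} r f = f {}"
  by (simp add: random_subset_def)

lemma event_prob_nonneg: "0 \<le> event_prob A r \<phi>"
  by simp

lemma event_prob_eq: "event_prob A r \<phi> = measure_pmf.prob (random_subset A r) {E. \<phi> E}"
proof -
  have "(\<lambda>E. of_bool (\<phi> E) :: real) = indicator {E. \<phi> E}"
    by (auto simp: indicator_def)
  then show ?thesis by simp
qed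

lemma event_prob_mono:
  assumes "finite A" "\<And>E. E \<subseteq> A \<Longrightarrow> \<phi> E \<Longrightarrow> \<psi> E"
  shows "event_prob A r \<phi> \<le> event_prob A r \<psi>"
  unfolding event_prob_eq using set_random_subset[OF assms(1), of r] assms(2)
  by (intro measure_pmf.finite_measure_mono_AE) (auto simp: AE_measure_pmf_iff)

lemma event_prob_not:
  assumes "finite A"
  shows "event_prob A r (\<lambda>E. \<not> \<phi> E) = 1 - event_prob A r \<phi>"
  using assms by (simp add: of_bool_not_iff)

lemma event_prob_or_le:
  assumes "finite A"
  shows "event_prob A r (\<lambda>E. \<phi> E \<or> \<psi> E) \<le> event_prob A r \<phi> + event_prob A r \<psi>"
proof -
  have "event_prob A r (\<lambda>E. \<phi> E \<or> \<psi> E) \<le> expect A r (\<lambda>E. of_bool (\<phi> E) + of_bool (\<psi> E))"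
    using assms by (intro integral_mono) auto
  then show ?thesis using assms by simp
qed

lemma event_prob_Bex_le:
  assumes "finite A" "finite F"
  shows "event_prob A r (\<lambda>E. \<exists>t\<in>F. \<phi> t E) \<le> (\<Sum>t\<in>F. event_prob A r (\<phi> t))"
  using assms(2)
proof (induction F)
  case (insert t F)
  have "event_prob A r (\<lambda>E. \<exists>t\<in>insert t F. \<phi> t E)
      \<le> event_prob A r (\<phi> t) + event_prob A r (\<lambda>E. \<exists>t\<in>F. \<phi> t E)"
    using event_prob_or_le[OF assms(1)] by simp
  then show ?case using insert by simp
qed simp

lemma event_prob_subset:
  assumes "finite A" "\<forall>e\<in>A. r e \<in> {0..1}" "S \<subseteq> A"
  shows "event_prob A r (\<lambda>E. S \<subseteq> E) = prod r S"
  using assms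
proof (induction A arbitrary: S rule: finite_induct)
  case (insert x A)
  have IH: "event_prob A r (\<lambda>E. S - {x} \<subseteq> E) = prod r (S - {x})"
    using insert by (intro insert.IH) auto
  have fS: "finite S" using insert finite_subset by auto
  have eq: "event_prob A r (\<lambda>E. S \<subseteq> insert x E) = event_prob A r (\<lambda>E. S - {x} \<subseteq> E)"
    by (simp add: Diff_subset_conv)
  show ?case
  proof (cases "x \<in> S")
    case True
    \<comment> \<open>When \<open>x\<close> is absent, no subset of \<open>A\<close> contains
      \<open>S\<close>, so only the branch that draws \<open>x\<close> contributes.\<close>
    have "event_prob A r (\<lambda>E. S \<subseteq> E) \<le> event_prob A r (\<lambda>_. False)"
      using True insert by (intro event_prob_mono) auto
    then have "event_prob A r (\<lambda>E. S \<subseteq> E) = 0"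
      using event_prob_nonneg[of A r "\<lambda>E. S \<subseteq> E"] by simp
    moreover have "prod r S = r x * prod r (S - {x})"
      using True fS by (simp add: prod.remove)
    ultimately show ?thesis
      using insert by (simp add: expect_insert eq IH)
  next
    case False
    then have "S - {x} = S" by simp
    then show ?thesis using insert IH
      by (simp add: expect_insert eq algebra_simps)
  qed
qed simp

section \<open>Correlation inequalities of Harris and of van den Berg and Kesten\<close>

lemma Harris_decreasing:
  assumes "finite A" "\<forall>e\<in>A. r e \<in> {0..1}"
    and "\<And>E E'. E \<subseteq> E' \<Longrightarrow> \<phi> E' \<Longrightarrow> \<phi> E" "\<And>E E'. E \<subseteq> E' \<Longrightarrow> \<psi> E' \<Longrightarrow> \<psi> E"
  shows "event_prob A r \<phi> * event_prob A r \<psi> \<le> event_prob A r (\<lambda>E. \<phi> E \<and> \<psi> E)"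
  using assms
proof (induction A arbitrary: \<phi> \<psi> rule: finite_induct)
  case (insert x A)
  let ?\<phi> = "\<lambda>E. \<phi> (insert x E)" and ?\<psi> = "\<lambda>E. \<psi> (insert x E)"
  define p a0 a1 b0 b1 where "p = r x" and "a0 = event_prob A r \<phi>" and "a1 = event_prob A r ?\<phi>"
    and "b0 = event_prob A r \<psi>" and "b1 = event_prob A r ?\<psi>"
  have p: "0 \<le> p" "p \<le> 1" using insert.prems(1) by (auto simp: p_def)
  have "a1 \<le> a0" unfolding a0_def a1_def using insert.prems(2) insert.hyps
    by (intro event_prob_mono) (auto intro: subset_insertI)
  moreover have "b1 \<le> b0" unfolding b0_def b1_def using insert.prems(3) insert.hyps
    by (intro event_prob_mono) (auto intro: subset_insertI)
  \<comment> \<open>This product is the covariance of the two conditional probabilities given the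
    state of \<open>x\<close>. Both drop when \<open>x\<close> is added, so it is nonnegative. The
    rest is the induction hypothesis in each state.\<close>
  ultimately have "0 \<le> p * (1 - p) * ((a0 - a1) * (b0 - b1))"
    using p by simp
  moreover have "a0 * b0 \<le> event_prob A r (\<lambda>E. \<phi> E \<and> \<psi> E)"
    unfolding a0_def b0_def using insert.prems by (intro insert.IH) auto
  moreover have "a1 * b1 \<le> event_prob A r (\<lambda>E. ?\<phi> E \<and> ?\<psi> E)"
    unfolding a1_def b1_def
    using insert.prems(1) insert.prems(2,3)[OF Set.insert_mono] by (intro insert.IH) auto
  ultimately have "p * (a1 * b1) + (1 - p) * (a0 * b0) \<le> p * event_prob A r (\<lambda>E. ?\<phi> E \<and> ?\<psi> E)
      + (1 - p) * event_prob A r (\<lambda>E. \<phi> E \<and> \<psi> E)"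
    using p by (intro add_mono mult_left_mono) auto
  moreover note \<open>0 \<le> p * (1 - p) * ((a0 - a1) * (b0 - b1))\<close>
  moreover have "p * (a1 * b1) + (1 - p) * (a0 * b0) - (p * a1 + (1 - p) * a0) * (p * b1 + (1 - p) * b0)
      = p * (1 - p) * ((a0 - a1) * (b0 - b1))"
    by algebra
  ultimately have "(p * a1 + (1 - p) * a0) * (p * b1 + (1 - p) * b0) \<le>
     p * event_prob A r (\<lambda>E. ?\<phi> E \<and> ?\<psi> E) + (1 - p) * event_prob A r (\<lambda>E. \<phi> E \<and> \<psi> E)"
    by linarith
  then show ?case
    using insert.hyps insert.prems(1)
    by (simp add: expect_insert p_def a0_def a1_def b0_def b1_def)
qed simp

text \<open>Avoiding a set is a decreasing event, so Harris' inequality, applied once per set,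
  bounds the probability of avoiding all of them from below by its value in the independent
  case.\<close>

lemma event_prob_avoid_ge:
  assumes A: "finite A" "\<forall>e\<in>A. r e \<in> {0..1}" and F: "finite F" "\<And>t. t \<in> F \<Longrightarrow> S t \<subseteq> A"
  shows "(\<Prod>t\<in>F. 1 - prod r (S t)) \<le> event_prob A r (\<lambda>E. \<forall>t\<in>F. \<not> S t \<subseteq> E)"
  using F
proof (induction F)
  case (insert t F)
  have "prod r (S t) \<le> 1"
    using insert.prems[of t] A(2) by (intro prod_le_1) auto
  then have "(\<Prod>t\<in>insert t F. 1 - prod r (S t))
      \<le> (1 - prod r (S t)) * event_prob A r (\<lambda>E. \<forall>t\<in>F. \<not> S t \<subseteq> E)"
    using insert by (simp add: mult_left_mono)
  also have "1 - prod r (S t) = event_prob A r (\<lambda>E. \<not> S t \<subseteq> E)"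
    using event_prob_subset[OF A, of "S t"] event_prob_not[OF A(1)] insert.prems by simp
  also have "event_prob A r (\<lambda>E. \<not> S t \<subseteq> E) * event_prob A r (\<lambda>E. \<forall>t\<in>F. \<not> S t \<subseteq> E)
      \<le> event_prob A r (\<lambda>E. \<not> S t \<subseteq> E \<and> (\<forall>t\<in>F. \<not> S t \<subseteq> E))"
    by (rule Harris_decreasing[OF A]) (use subset_trans in blast)+
  finally show ?case by simp
qed simp

text \<open>Two independent copies of the random subset: one has to contain the first member of a
  pair, the other the second. For a product family of pairs this probability factorises, which turns
  \<open>BK_joint\<close> into the usual product bound.\<close>

definition joint_prob :: "'a set \<Rightarrow> ('a \<Rightarrow> real) \<Rightarrow> ('a set \<times> 'a set) set \<Rightarrow> real" where
  "joint_prob A r Q = expect A r (\<lambda>E. event_prob A r (\<lambda>E'. \<exists>(S, S')\<in>Q. S \<subseteq> E \<and> S' \<subseteq> E'))"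

text \<open>Domination rather than inclusion of the families: deleting an element from the members
  of a pair only makes the pair easier to realise.\<close>

lemma joint_prob_mono:
  assumes "finite A" "\<And>S S'. (S, S') \<in> Q \<Longrightarrow> \<exists>(S1, S2)\<in>Q'. S1 \<subseteq> S \<and> S2 \<subseteq> S'"
  shows "joint_prob A r Q \<le> joint_prob A r Q'"
  unfolding joint_prob_def
proof (intro integral_mono)
  fix E E'
  have "\<exists>(S, S')\<in>Q'. S \<subseteq> E \<and> S' \<subseteq> E'" if "\<exists>(S, S')\<in>Q. S \<subseteq> E \<and> S' \<subseteq> E'"
  proof -
    from that obtain S S' where S: "(S, S') \<in> Q" "S \<subseteq> E" "S' \<subseteq> E'" by blast
    from assms(2)[OF S(1)] obtain S1 S2 where "(S1, S2) \<in> Q'" "S1 \<subseteq> S" "S2 \<subseteq> S'" by blast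
    with S show ?thesis by blast
  qed
  then show "of_bool (\<exists>(S, S')\<in>Q. S \<subseteq> E \<and> S' \<subseteq> E') \<le> (of_bool (\<exists>(S, S')\<in>Q'. S \<subseteq> E \<and> S' \<subseteq> E') :: real)"
    unfolding of_bool_def by (simp only: if_True if_False split: if_split) auto
qed (use assms(1) in auto)

text \<open>Pointwise, the event for \<open>Q \<union> Q'\<close> is the disjunction of the two
  events, while the event for \<open>Q \<inter> Q'\<close> implies both of them.\<close>

lemma joint_prob_Un:
  assumes "finite A"
  shows "joint_prob A r (Q \<union> Q') + joint_prob A r (Q \<inter> Q') \<le> joint_prob A r Q + joint_prob A r Q'"
proof -
  let ?f = "\<lambda>Q E E'. of_bool (\<exists>(S, S')\<in>Q. S \<subseteq> E \<and> S' \<subseteq> E') :: real"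
  have "expect A r (\<lambda>E. expect A r (\<lambda>E'. ?f (Q \<union> Q') E E' + ?f (Q \<inter> Q') E E'))
      \<le> expect A r (\<lambda>E. expect A r (\<lambda>E'. ?f Q E E' + ?f Q' E E'))"
    using assms by (intro integral_mono) (auto simp: of_bool_def)
  then show ?thesis using assms by (simp add: joint_prob_def)
qed

lemma nested_prob_mono:
  assumes "finite A" "\<And>E E'. \<phi> E E' \<Longrightarrow> \<psi> E E'"
  shows "expect A r (\<lambda>E. event_prob A r (\<phi> E)) \<le> expect A r (\<lambda>E. event_prob A r (\<psi> E))"
  using assms by (intro integral_mono event_prob_mono) auto

text \<open>Splitting one coordinate into two independent copies, one for each member of the pair, can
  only help; splitting all of them decouples the pair. The pair family is kept arbitrary, rather
  than a product, so that it is preserved by conditioning on a coordinate.\<close>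

lemma BK_joint:
  assumes "finite A" "\<forall>e\<in>A. r e \<in> {0..1}"
  shows "event_prob A r (\<lambda>E. \<exists>(S, S')\<in>Q. S \<inter> S' = {} \<and> S \<subseteq> E \<and> S' \<subseteq> E) \<le> joint_prob A r Q"
  using assms
proof (induction A arbitrary: Q rule: finite_induct)
  case empty
  show ?case by (auto simp: joint_prob_def)
next
  case (insert x A)
  define p where "p = r x"
  have p: "0 \<le> p" "p \<le> 1" using insert.prems by (auto simp: p_def)
  \<comment> \<open>The four families describe what remains to be realised on \<open>A\<close> when
    \<open>x\<close> is present in neither copy (\<open>Q0\<close>), in the first only
    (\<open>Qa\<close>), in the second only (\<open>Qb\<close>), or in both
    (\<open>Qc\<close>).\<close>
  define Q0 where "Q0 = {(S, S') \<in> Q. x \<notin> S \<and> x \<notin> S'}"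
  define Qa where "Qa = {(S - {x}, S') |S S'. (S, S') \<in> Q \<and> x \<notin> S'}"
  define Qb where "Qb = {(S, S' - {x}) |S S'. (S, S') \<in> Q \<and> x \<notin> S}"
  define Qc where "Qc = {(S - {x}, S' - {x}) |S S'. (S, S') \<in> Q}"
  have Bex: "(\<exists>(S, S')\<in>R. P S S') \<longleftrightarrow> (\<exists>S S'. (S, S') \<in> R \<and> P S S')" for R :: "('a set \<times> 'a set) set" and P
    by blast
  let ?D = "\<lambda>Q. event_prob A r (\<lambda>E. \<exists>(S, S')\<in>Q. S \<inter> S' = {} \<and> S \<subseteq> E \<and> S' \<subseteq> E)"
  have IH: "?D Q \<le> joint_prob A r Q" for Q
    using insert by auto
  have "event_prob A r (\<lambda>E. \<exists>(S, S')\<in>Q. S \<inter> S' = {} \<and> S \<subseteq> E \<and> S' \<subseteq> E) \<le> ?D Q0"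
    using insert.hyps by (intro event_prob_mono) (auto simp: Q0_def Bex, blast)
  also note IH
  finally have 0: "event_prob A r (\<lambda>E. \<exists>(S, S')\<in>Q. S \<inter> S' = {} \<and> S \<subseteq> E \<and> S' \<subseteq> E) \<le> joint_prob A r Q0" .
  \<comment> \<open>At most one member of a disjoint pair contains \<open>x\<close>; a pair in which
    neither does is covered by \<open>Qa\<close>.\<close>
  have "event_prob A r (\<lambda>E. \<exists>(S, S')\<in>Q. S \<inter> S' = {} \<and> S \<subseteq> insert x E \<and> S' \<subseteq> insert x E) \<le> ?D (Qa \<union> Qb)"
  proof (rule event_prob_mono[OF insert.hyps(1)])
    fix E assume "\<exists>(S, S')\<in>Q. S \<inter> S' = {} \<and> S \<subseteq> insert x E \<and> S' \<subseteq> insert x E"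
    then obtain S S' where S: "(S, S') \<in> Q" "S \<inter> S' = {}" "S \<subseteq> insert x E" "S' \<subseteq> insert x E"
      by blast
    show "\<exists>(S, S')\<in>Qa \<union> Qb. S \<inter> S' = {} \<and> S \<subseteq> E \<and> S' \<subseteq> E"
    proof (cases "x \<in> S'")
      case True
      then have "(S, S' - {x}) \<in> Qb" "S \<subseteq> E" using S by (auto simp: Qb_def)
      then show ?thesis using S by (intro bexI[of _ "(S, S' - {x})"]) auto
    next
      case False
      then have "(S - {x}, S') \<in> Qa" "S' \<subseteq> E" using S by (auto simp: Qa_def)
      then show ?thesis using S by (intro bexI[of _ "(S - {x}, S')"]) auto
    qed
  qed
  also note IH
  finally have 1: "event_prob A r (\<lambda>E. \<exists>(S, S')\<in>Q. S \<inter> S' = {} \<and> S \<subseteq> insert x E \<and> S' \<subseteq> insert x E)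
    \<le> joint_prob A r (Qa \<union> Qb)" .
  \<comment> \<open>\<open>Q0\<close> lies in both \<open>Qa\<close> and \<open>Qb\<close>, so
    \<open>joint_prob_Un\<close> bounds the union together with \<open>Q0\<close> by
    \<open>Qa\<close> and \<open>Qb\<close> taken separately.\<close>
  have "(S, S') \<in> Qa \<and> (S, S') \<in> Qb" if "(S, S') \<in> Q0" for S S'
  proof -
    from that have S: "(S, S') \<in> Q" "x \<notin> S" "x \<notin> S'" by (auto simp: Q0_def)
    then have "S = S - {x}" "S' = S' - {x}" by auto
    with S show ?thesis unfolding Qa_def Qb_def by blast
  qed
  then have "joint_prob A r Q0 \<le> joint_prob A r (Qa \<inter> Qb)"
    using insert.hyps by (intro joint_prob_mono) blast+
  then have U: "joint_prob A r (Qa \<union> Qb) + joint_prob A r Q0 \<le> joint_prob A r Qa + joint_prob A r Qb"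
    using joint_prob_Un[of A r Qa Qb] insert.hyps by linarith
  have C: "joint_prob A r (Qa \<union> Qb) \<le> joint_prob A r Qc"
  proof (rule joint_prob_mono[OF insert.hyps(1)])
    fix S S' assume "(S, S') \<in> Qa \<union> Qb"
    then obtain U U' where "(U, U') \<in> Q" "U - {x} \<subseteq> S" "U' - {x} \<subseteq> S'"
      unfolding Qa_def Qb_def by blast
    then show "\<exists>(S1, S2)\<in>Qc. S1 \<subseteq> S \<and> S2 \<subseteq> S'"
      unfolding Qc_def by blast
  qed
  have j: "expect A r (\<lambda>E. event_prob A r (\<lambda>E'. \<exists>(S, S')\<in>Q. S \<subseteq> E \<and> S' \<subseteq> E')) \<ge> joint_prob A r Q0"
    "expect A r (\<lambda>E. event_prob A r (\<lambda>E'. \<exists>(S, S')\<in>Q. S \<subseteq> insert x E \<and> S' \<subseteq> E')) \<ge> joint_prob A r Qa"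
    "expect A r (\<lambda>E. event_prob A r (\<lambda>E'. \<exists>(S, S')\<in>Q. S \<subseteq> E \<and> S' \<subseteq> insert x E')) \<ge> joint_prob A r Qb"
    "expect A r (\<lambda>E. event_prob A r (\<lambda>E'. \<exists>(S, S')\<in>Q. S \<subseteq> insert x E \<and> S' \<subseteq> insert x E')) \<ge> joint_prob A r Qc"
  proof -
    show "joint_prob A r Q0 \<le> expect A r (\<lambda>E. event_prob A r (\<lambda>E'. \<exists>(S, S')\<in>Q. S \<subseteq> E \<and> S' \<subseteq> E'))"
      unfolding joint_prob_def by (rule nested_prob_mono[OF insert.hyps(1)]) (auto simp: Q0_def Bex)
    show "joint_prob A r Qa \<le> expect A r (\<lambda>E. event_prob A r (\<lambda>E'. \<exists>(S, S')\<in>Q. S \<subseteq> insert x E \<and> S' \<subseteq> E'))"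
      unfolding joint_prob_def by (rule nested_prob_mono[OF insert.hyps(1)]) (auto simp: Qa_def Bex subset_insert_iff)
    show "joint_prob A r Qb \<le> expect A r (\<lambda>E. event_prob A r (\<lambda>E'. \<exists>(S, S')\<in>Q. S \<subseteq> E \<and> S' \<subseteq> insert x E'))"
      unfolding joint_prob_def by (rule nested_prob_mono[OF insert.hyps(1)]) (auto simp: Qb_def Bex subset_insert_iff)
    show "joint_prob A r Qc \<le> expect A r (\<lambda>E. event_prob A r (\<lambda>E'. \<exists>(S, S')\<in>Q. S \<subseteq> insert x E \<and> S' \<subseteq> insert x E'))"
      unfolding joint_prob_def by (rule nested_prob_mono[OF insert.hyps(1)]) (auto simp: Qc_def Bex subset_insert_iff)
  qed
  have "joint_prob (insert x A) r Q \<ge>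
      p * (p * joint_prob A r Qc + (1 - p) * joint_prob A r Qb)
      + (1 - p) * (p * joint_prob A r Qa + (1 - p) * joint_prob A r Q0)"
    unfolding joint_prob_def[of "insert x A"]
    using insert.hyps insert.prems p
    by (simp add: expect_insert flip: p_def) (intro add_mono mult_left_mono j; simp)
  also have "p * (p * joint_prob A r Qc + (1 - p) * joint_prob A r Qb)
      + (1 - p) * (p * joint_prob A r Qa + (1 - p) * joint_prob A r Q0)
      = p * p * joint_prob A r Qc + p * (1 - p) * (joint_prob A r Qa + joint_prob A r Qb)
      + (1 - p) * (1 - p) * joint_prob A r Q0"
    by algebra
  \<comment> \<open>With \<open>x\<close> in both copies, \<open>Qc\<close> is bounded below by
    \<open>Qa \<union> Qb\<close>; with \<open>x\<close> in exactly one, \<open>U\<close> is used.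
    The weights then collapse because \<open>p * p + p * (1 - p) = p\<close>.\<close>
  also have "\<dots> \<ge> p * p * joint_prob A r (Qa \<union> Qb)
      + p * (1 - p) * (joint_prob A r (Qa \<union> Qb) + joint_prob A r Q0)
      + (1 - p) * (1 - p) * joint_prob A r Q0"
    using p by (intro add_mono mult_left_mono C U order_refl) auto
  also have "p * p * joint_prob A r (Qa \<union> Qb)
      + p * (1 - p) * (joint_prob A r (Qa \<union> Qb) + joint_prob A r Q0)
      + (1 - p) * (1 - p) * joint_prob A r Q0 = p * joint_prob A r (Qa \<union> Qb) + (1 - p) * joint_prob A r Q0"
    by algebra
  also have "\<dots> \<ge> p * event_prob A r (\<lambda>E. \<exists>(S, S')\<in>Q. S \<inter> S' = {} \<and> S \<subseteq> insert x E \<and> S' \<subseteq> insert x E)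
     + (1 - p) * event_prob A r (\<lambda>E. \<exists>(S, S')\<in>Q. S \<inter> S' = {} \<and> S \<subseteq> E \<and> S' \<subseteq> E)"
    using p by (intro add_mono mult_left_mono 0 1) auto
  finally show ?case
    using insert.hyps insert.prems by (simp add: expect_insert p_def)
qed

text \<open>Two witnesses contained in \<open>E\<close> are either disjoint, which
  \<open>BK_joint\<close> handles with a product family of pairs, or they overlap, which a union
  bound over their unions handles. The sum thus bounds the covariance of the two events.\<close>

lemma event_prob_conj_le:
  assumes A: "finite A" "\<forall>e\<in>A. r e \<in> {0..1}"
    and F: "finite F" "finite F'" "\<And>t. t \<in> F \<union> F' \<Longrightarrow> S t \<subseteq> A"
  shows "event_prob A r (\<lambda>E. (\<exists>t\<in>F. S t \<subseteq> E) \<and> (\<exists>t\<in>F'. S t \<subseteq> E))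
    \<le> event_prob A r (\<lambda>E. \<exists>t\<in>F. S t \<subseteq> E) * event_prob A r (\<lambda>E. \<exists>t\<in>F'. S t \<subseteq> E)
      + (\<Sum>(t, t') | (t, t') \<in> F \<times> F' \<and> S t \<inter> S t' \<noteq> {}. prod r (S t \<union> S t'))"
proof -
  let ?Q = "(S ` F) \<times> (S ` F')"
  let ?I = "{(t, t'). (t, t') \<in> F \<times> F' \<and> S t \<inter> S t' \<noteq> {}}"
  have fin: "finite ?I" by (rule finite_subset[of _ "F \<times> F'"]) (use F in auto)
  have "event_prob A r (\<lambda>E. (\<exists>t\<in>F. S t \<subseteq> E) \<and> (\<exists>t\<in>F'. S t \<subseteq> E))
    \<le> event_prob A r (\<lambda>E. (\<exists>(S, S')\<in>?Q. S \<inter> S' = {} \<and> S \<subseteq> E \<and> S' \<subseteq> E)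
         \<or> (\<exists>u\<in>?I. S (fst u) \<union> S (snd u) \<subseteq> E))"
  proof (rule event_prob_mono[OF A(1)])
    fix E assume "(\<exists>t\<in>F. S t \<subseteq> E) \<and> (\<exists>t\<in>F'. S t \<subseteq> E)"
    then obtain t t' where t: "t \<in> F" "t' \<in> F'" "S t \<subseteq> E" "S t' \<subseteq> E" by blast
    show "(\<exists>(S, S')\<in>?Q. S \<inter> S' = {} \<and> S \<subseteq> E \<and> S' \<subseteq> E) \<or> (\<exists>u\<in>?I. S (fst u) \<union> S (snd u) \<subseteq> E)"
    proof (cases "S t \<inter> S t' = {}")
      case True
      then show ?thesis using t by (intro disjI1 bexI[of _ "(S t, S t')"]) auto
    next
      case False
      then show ?thesis using t by (intro disjI2 bexI[of _ "(t, t')"]) auto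
    qed
  qed
  also have "\<dots> \<le> joint_prob A r ?Q + (\<Sum>u\<in>?I. event_prob A r (\<lambda>E. S (fst u) \<union> S (snd u) \<subseteq> E))"
    by (rule order_trans[OF event_prob_or_le[OF A(1)]])
       (intro add_mono BK_joint event_prob_Bex_le A fin)
  also have "joint_prob A r ?Q = event_prob A r (\<lambda>E. \<exists>t\<in>F. S t \<subseteq> E) * event_prob A r (\<lambda>E. \<exists>t\<in>F'. S t \<subseteq> E)"
  proof -
    have "(\<exists>(S, S')\<in>?Q. S \<subseteq> E \<and> S' \<subseteq> E') \<longleftrightarrow> (\<exists>t\<in>F. S t \<subseteq> E) \<and> (\<exists>t\<in>F'. S t \<subseteq> E')" for E E'
      by blast
    then show ?thesis by (simp only: joint_prob_def of_bool_conj) (use A in simp)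
  qed
  also have "(\<Sum>u\<in>?I. event_prob A r (\<lambda>E. S (fst u) \<union> S (snd u) \<subseteq> E)) = (\<Sum>u\<in>?I. prod r (S (fst u) \<union> S (snd u)))"
    using subsetD[OF F(3)] by (intro sum.cong refl event_prob_subset A) (auto; blast)
  finally show ?thesis by (simp add: case_prod_unfold)
qed

text \<open>Chebyshev's inequality for a count of events, where \<delta> is an upper bound for the
  covariances, the diagonal included.\<close>

lemma count_deviation:
  assumes A: "finite A" and J: "finite J" and t: "t > 0"
    and cov: "\<And>i j. i \<in> J \<Longrightarrow> j \<in> J \<Longrightarrow>
       event_prob A r (\<lambda>E. \<phi> i E \<and> \<phi> j E) \<le> event_prob A r (\<phi> i) * event_prob A r (\<phi> j) + \<delta> i j"
  shows "event_prob A r (\<lambda>E. \<bar>real (card {j \<in> J. \<phi> j E}) - (\<Sum>j\<in>J. event_prob A r (\<phi> j))\<bar> \<ge> t)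
    \<le> (\<Sum>i\<in>J. \<Sum>j\<in>J. \<delta> i j) / t\<^sup>2"
proof -
  define X where "X E = (\<Sum>j\<in>J. of_bool (\<phi> j E) :: real)" for E
  define \<mu> where "\<mu> = (\<Sum>j\<in>J. event_prob A r (\<phi> j))"
  have X: "real (card {j \<in> J. \<phi> j E}) = X E" for E
    using J by (simp add: X_def Int_def)
  have EX: "expect A r X = \<mu>" using A by (simp add: X_def[abs_def] \<mu>_def)
  have "expect A r (\<lambda>E. (X E)\<^sup>2) = (\<Sum>i\<in>J. \<Sum>j\<in>J. event_prob A r (\<lambda>E. \<phi> i E \<and> \<phi> j E))"
    using A by (simp add: X_def power2_eq_square sum_product of_bool_conj)
  also have "\<dots> \<le> (\<Sum>i\<in>J. \<Sum>j\<in>J. event_prob A r (\<phi> i) * event_prob A r (\<phi> j) + \<delta> i j)"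
    by (intro sum_mono cov)
  also have "\<dots> = \<mu>\<^sup>2 + (\<Sum>i\<in>J. \<Sum>j\<in>J. \<delta> i j)"
    by (simp add: sum.distrib \<mu>_def power2_eq_square sum_product)
  finally have 2: "expect A r (\<lambda>E. (X E)\<^sup>2) \<le> \<mu>\<^sup>2 + (\<Sum>i\<in>J. \<Sum>j\<in>J. \<delta> i j)" .
  have "event_prob A r (\<lambda>E. \<bar>X E - \<mu>\<bar> \<ge> t) \<le> expect A r (\<lambda>E. (X E - \<mu>)\<^sup>2 / t\<^sup>2)"
  proof (intro integral_mono)
    fix E
    have "t\<^sup>2 \<le> (X E - \<mu>)\<^sup>2" if "\<bar>X E - \<mu>\<bar> \<ge> t"
      using that t by (metis abs_ge_zero abs_le_square_iff abs_of_pos)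
    then show "of_bool (t \<le> \<bar>X E - \<mu>\<bar>) \<le> (X E - \<mu>)\<^sup>2 / t\<^sup>2"
      using t by (auto simp: of_bool_def)
  qed (use A in auto)
  also have "\<dots> = (expect A r (\<lambda>E. (X E)\<^sup>2) - \<mu>\<^sup>2) / t\<^sup>2"
  proof -
    have "(\<lambda>E. (X E - \<mu>)\<^sup>2) = (\<lambda>E. (X E)\<^sup>2 - 2 * \<mu> * X E + \<mu>\<^sup>2)"
      by (auto simp: power2_eq_square algebra_simps)
    then have "expect A r (\<lambda>E. (X E - \<mu>)\<^sup>2) = expect A r (\<lambda>E. (X E)\<^sup>2) - 2 * \<mu> * expect A r X + \<mu>\<^sup>2"
      using A by simp
    then show ?thesis by (simp add: EX power2_eq_square)
  qed
  also have "\<dots> \<le> (\<Sum>i\<in>J. \<Sum>j\<in>J. \<delta> i j) / t\<^sup>2"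
    using 2 t by (intro divide_right_mono) auto
  finally show ?thesis by (simp add: X \<mu>_def)
qed

section \<open>Paths\<close>

fun path_edges :: "'a list \<Rightarrow> 'a set set" where
  "path_edges (u # v # vs) = insert {u, v} (path_edges (v # vs))"
| "path_edges _ = {}"

lemma path_edges_subset: "e \<in> path_edges vs \<Longrightarrow> e \<subseteq> set vs"
  by (induction vs rule: path_edges.induct) auto

lemma finite_path_edges [simp]: "finite (path_edges vs)"
  by (induction vs rule: path_edges.induct) auto

lemma card_path_edges: "distinct vs \<Longrightarrow> card (path_edges vs) = length vs - 1"
proof (induction vs rule: path_edges.induct)
  case (1 u v vs)
  then have "{u, v} \<notin> path_edges (v # vs)"
    using path_edges_subset[of "{u, v}" "v # vs"] by auto
  then show ?case using 1 by simp
qed auto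

lemma path_edges_snoc: "vs \<noteq> [] \<Longrightarrow> path_edges (vs @ [w]) = insert {last vs, w} (path_edges vs)"
  by (induction vs rule: path_edges.induct) auto

lemma path_edges_append: "path_edges vs \<subseteq> path_edges (vs @ ws)"
  by (induction vs rule: path_edges.induct) auto

lemma finite_node_pairs [simp]: "finite (node_pairs n)"
  by (simp add: node_pairs_def)

lemma card_node_pairs: "card (node_pairs n) = n choose 2"
  by (simp add: node_pairs_def n_subsets)

lemma doubleton_in_node_pairs:
  "{i, j} \<in> node_pairs n \<longleftrightarrow> i \<in> {1..n} \<and> j \<in> {1..n} \<and> i \<noteq> j"
  by (auto simp: node_pairs_def card_2_iff doubleton_eq_iff)

lemma node_pairsE:
  assumes "e \<in> node_pairs n"
  obtains i j where "e = {i, j}" "i \<in> {1..n}" "j \<in> {1..n}" "i < j"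
proof -
  from assms obtain i j where "e = {i, j}" "i \<noteq> j"
    by (auto simp: node_pairs_def card_2_iff)
  then show thesis using assms that[of i j] that[of j i]
    by (metis doubleton_in_node_pairs insert_commute linorder_neqE_nat)
qed

lemma path_edges_node_pairs:
  "distinct vs \<Longrightarrow> set vs \<subseteq> {1..n} \<Longrightarrow> path_edges vs \<subseteq> node_pairs n"
  by (induction vs rule: path_edges.induct) (auto simp: doubleton_in_node_pairs)

text \<open>A path outside \<open>W\<close> except for at least one vertex contributes at least as many new edges as
  new vertices.\<close>

lemma card_new_vertices_le:
  assumes "distinct ws" "W \<inter> set ws \<noteq> {}"
  shows "card (set ws - W) \<le> card {e \<in> path_edges ws. \<not> e \<subseteq> W}"
  using assms
proof (induction ws rule: path_edges.induct)
  case (1 u v vs)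
  let ?F = "\<lambda>ws. {e \<in> path_edges ws. \<not> e \<subseteq> W}"
  have new: "{u, v} \<notin> path_edges (v # vs)"
    using path_edges_subset[of "{u, v}" "v # vs"] 1 by auto
  show ?case
  proof (cases "W \<inter> set (v # vs) = {}")
    \<comment> \<open>Here \<open>u\<close> is the only vertex of the path in \<open>W\<close>, so
      every edge is new, and the new vertices are those of \<open>v # vs\<close>, as many as the
      edges.\<close>
    case True
    then have u: "u \<in> W" and v: "v \<notin> W" using 1 by auto
    have "set (u # v # vs) - W = set (v # vs)" using u True by auto
    then have "card (set (u # v # vs) - W) = length (v # vs)"
      using 1 distinct_card[of "v # vs"] by simp
    moreover have "?F (u # v # vs) = path_edges (u # v # vs)"
    proof -
      have "\<not> e \<subseteq> W" if "e \<in> path_edges (v # vs)" for e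
      proof -
        from that have "e \<subseteq> set (v # vs)" by (rule path_edges_subset)
        moreover have "e \<noteq> {}" using that
          by (induction "v # vs" arbitrary: v vs rule: path_edges.induct) auto
        ultimately show ?thesis using True by blast
      qed
      then show ?thesis using v by auto
    qed
    ultimately show ?thesis using card_path_edges[of "u # v # vs"] 1 by simp
  next
    case False
    then have IH: "card (set (v # vs) - W) \<le> card (?F (v # vs))"
      using 1 by auto
    show ?thesis
    proof (cases "u \<in> W")
      case True
      then have "set (u # v # vs) - W = set (v # vs) - W" by auto
      also have "card \<dots> \<le> card (?F (u # v # vs))"
        by (rule order_trans[OF IH]) (intro card_mono; auto)
      finally show ?thesis .
    next
      case False
      have "set (u # v # vs) - W = insert u (set (v # vs) - W)" using False by auto
      then have "card (set (u # v # vs) - W) = Suc (card (set (v # vs) - W))"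
        using 1 by simp
      moreover have "?F (u # v # vs) = insert {u, v} (?F (v # vs))" using False by auto
      then have "card (?F (u # v # vs)) = Suc (card (?F (v # vs)))"
        using new by simp
      ultimately show ?thesis using IH by simp
    qed
  qed
qed auto

text \<open>The union of two paths with a common vertex is connected: the first path has one vertex
  more than edges, and the second adds at least as many new edges as new vertices.\<close>

lemma card_vertices_le:
  assumes "distinct vs" "distinct ws" "set vs \<inter> set ws \<noteq> {}"
  shows "card (set vs \<union> set ws) \<le> Suc (card (path_edges vs \<union> path_edges ws))"
proof -
  let ?F = "{e \<in> path_edges ws. \<not> e \<subseteq> set vs}"
  have "card (set vs \<union> set ws) = card (set vs) + card (set ws - set vs)"
    by (metis Un_Diff_cancel card_Un_disjoint Diff_disjoint List.finite_set finite_Diff)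
  also have "card (set vs) \<le> Suc (card (path_edges vs))"
    using assms by (simp add: card_path_edges distinct_card)
  also have "card (set ws - set vs) \<le> card ?F"
    using assms by (intro card_new_vertices_le)
  also have "Suc (card (path_edges vs)) + card ?F = Suc (card (path_edges vs \<union> ?F))"
    using path_edges_subset[of _ vs] by (subst card_Un_disjoint) auto
  also have "\<dots> \<le> Suc (card (path_edges vs \<union> path_edges ws))"
    by (intro Suc_leI le_imp_less_Suc card_mono) auto
  finally show ?thesis by simp
qed

text \<open>The parameter \<open>k\<close> bounds the number of edges, hence at most
  \<open>Suc k\<close> vertices; the lower bound on the length excludes paths without edges.\<close>

definition all_paths :: "nat \<Rightarrow> nat \<Rightarrow> nat list set" where
  "all_paths n k = {vs. distinct vs \<and> set vs \<subseteq> {1..n} \<and> 2 \<le> length vs \<and> length vs \<le> Suc k}"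

text \<open>Listed from the smaller end to the larger one, so that a path belongs to at most one
  node pair and sums over pairs of paths have no repetitions.\<close>

definition paths :: "nat \<Rightarrow> nat \<Rightarrow> nat set \<Rightarrow> nat list set" where
  "paths n k e = {vs \<in> all_paths n k. hd vs = Min e \<and> last vs = Max e}"

text \<open>Expresses that the ends of \<open>e\<close> are at distance at most \<open>k\<close>.
  Simple paths are the witnesses, so that the event has the form treated by
  \<open>event_prob_avoid_ge\<close> and \<open>event_prob_conj_le\<close>.\<close>

definition linked :: "nat \<Rightarrow> nat \<Rightarrow> nat set set \<Rightarrow> nat set \<Rightarrow> bool" where
  "linked n k E e \<longleftrightarrow> (\<exists>vs\<in>paths n k e. path_edges vs \<subseteq> E)"

lemma finite_all_paths [simp]: "finite (all_paths n k)"
  by (rule finite_subset[OF _ finite_lists_length_le[of "{1..n}" "Suc k"]]) (auto simp: all_paths_def)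

lemma finite_paths [simp]: "finite (paths n k e)"
  by (simp add: paths_def)

lemma all_paths_edges: "vs \<in> all_paths n k \<Longrightarrow> path_edges vs \<subseteq> node_pairs n"
  by (simp add: all_paths_def path_edges_node_pairs)

text \<open>Once the ends are fixed, a path with \<open>m\<close> edges is determined by its
  \<open>m - 1\<close> interior vertices.\<close>

lemma card_paths_length:
  assumes "1 \<le> m"
  shows "card {vs \<in> paths n k e. length vs = Suc m} \<le> n ^ (m - 1)"
proof -
  let ?U = "{us. set us \<subseteq> {1..n} \<and> length us = m - 1}"
  have "{vs \<in> paths n k e. length vs = Suc m} \<subseteq> (\<lambda>us. Min e # us @ [Max e]) ` ?U"
  proof
    fix vs assume "vs \<in> {vs \<in> paths n k e. length vs = Suc m}"
    then have vs: "hd vs = Min e" "last vs = Max e" "set vs \<subseteq> {1..n}" "length vs = Suc m" "2 \<le> length vs"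
      by (auto simp: paths_def all_paths_def)
    then obtain ws where "vs = Min e # ws"
      by (cases vs) auto
    moreover from this have "ws \<noteq> []" using vs by auto
    ultimately have ws: "vs = Min e # ws" "ws \<noteq> []" by auto
    then have "vs = Min e # butlast ws @ [Max e]"
      using vs append_butlast_last_id[of ws] by auto
    moreover have "butlast ws \<in> ?U"
      using vs ws by (auto dest: in_set_butlastD)
    ultimately show "vs \<in> (\<lambda>us. Min e # us @ [Max e]) ` ?U" by blast
  qed
  then have "card {vs \<in> paths n k e. length vs = Suc m} \<le> card ((\<lambda>us. Min e # us @ [Max e]) ` ?U)"
    by (intro card_mono finite_imageI finite_lists_length_eq) auto
  also have "\<dots> \<le> card ?U"
    by (intro card_image_le finite_lists_length_eq) auto
  also have "\<dots> = n ^ (m - 1)"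
    by (simp add: card_lists_length_eq)
  finally show ?thesis .
qed

text \<open>Paths are grouped by their number \<open>m\<close> of edges. This makes the bound of
  \<open>event_prob_avoid_ge\<close> independent of the pair \<open>e\<close> and of the individual
  rates.\<close>

lemma prod_paths_ge:
  fixes r :: "nat set \<Rightarrow> real"
  assumes r: "\<And>e. e \<in> node_pairs n \<Longrightarrow> 0 \<le> r e \<and> r e \<le> p" and p: "p \<le> 1" "0 \<le> p"
  shows "(\<Prod>m=1..k. (1 - p ^ m) ^ (n ^ (m - 1))) \<le> (\<Prod>vs\<in>paths n k e. 1 - prod r (path_edges vs))"
proof -
  have "(1 - p ^ m) ^ (n ^ (m - 1)) \<le> (\<Prod>vs | vs \<in> paths n k e \<and> length vs = Suc m. 1 - prod r (path_edges vs))"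
    if m: "m \<in> {1..k}" for m
  proof -
    have "(1 - p ^ m) ^ (n ^ (m - 1)) \<le> (1 - p ^ m) ^ card {vs \<in> paths n k e. length vs = Suc m}"
      using m p by (intro power_decreasing card_paths_length) (auto simp: power_le_one)
    also have "\<dots> = (\<Prod>vs | vs \<in> paths n k e \<and> length vs = Suc m. 1 - p ^ m)"
      by simp
    also have "\<dots> \<le> (\<Prod>vs | vs \<in> paths n k e \<and> length vs = Suc m. 1 - prod r (path_edges vs))"
    proof (intro prod_mono conjI)
      fix vs assume "vs \<in> {vs. vs \<in> paths n k e \<and> length vs = Suc m}"
      then have vs: "vs \<in> all_paths n k" "length vs = Suc m" "distinct vs"
        by (auto simp: paths_def all_paths_def)
      have "prod r (path_edges vs) \<le> (\<Prod>e\<in>path_edges vs. p)"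
        using r all_paths_edges[OF vs(1)] by (intro prod_mono) auto
      also have "\<dots> = p ^ m" using vs by (simp add: card_path_edges)
      finally show "1 - p ^ m \<le> 1 - prod r (path_edges vs)" by simp
      show "0 \<le> 1 - p ^ m" using p by (simp add: power_le_one)
    qed
    finally show ?thesis .
  qed
  then have "(\<Prod>m=1..k. (1 - p ^ m) ^ (n ^ (m - 1)))
      \<le> (\<Prod>m=1..k. \<Prod>vs | vs \<in> paths n k e \<and> length vs = Suc m. 1 - prod r (path_edges vs))"
    using p by (intro prod_mono) (auto simp: power_le_one)
  \<comment> \<open>Paths have at least two vertices, so the truncated subtraction is harmless; it
    brings the condition into the form of \<open>prod.group\<close>.\<close>
  also have "(\<Prod>m=1..k. \<Prod>vs | vs \<in> paths n k e \<and> length vs = Suc m. 1 - prod r (path_edges vs))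
     = (\<Prod>m=1..k. \<Prod>vs | vs \<in> paths n k e \<and> length vs - 1 = m. 1 - prod r (path_edges vs))"
    by (intro prod.cong) (auto simp: paths_def all_paths_def)
  also have "\<dots> = (\<Prod>vs\<in>paths n k e. 1 - prod r (path_edges vs))"
    by (rule prod.group[OF finite_paths]) (auto simp: paths_def all_paths_def)
  finally show ?thesis .
qed

text \<open>Bounds the sum of all covariances between links. Here \<open>c\<close> is the number of
  vertices in the union of two paths that share an edge: there are at most \<open>n ^ c\<close>
  vertex sets, each carries a number of pairs of paths bounded in terms of \<open>k\<close> alone,
  and the union has at least \<open>c - 1\<close> edges.\<close>

definition overlap_bound :: "nat \<Rightarrow> nat \<Rightarrow> real \<Rightarrow> real" where
  "overlap_bound n k p =
     real (\<Sum>i\<le>Suc k. (2 * k + 1) ^ i) ^ 2 * (\<Sum>c=1..2 * k + 1. real n ^ c * p ^ (c - 1))"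

lemma sum_overlap_le:
  assumes p: "0 \<le> p" "p \<le> 1"
  shows "(\<Sum>(vs, ws) | (vs, ws) \<in> all_paths n k \<times> all_paths n k \<and> path_edges vs \<inter> path_edges ws \<noteq> {}.
      p ^ card (path_edges vs \<union> path_edges ws)) \<le> overlap_bound n k p"
proof -
  let ?S = "{(vs, ws). (vs, ws) \<in> all_paths n k \<times> all_paths n k \<and> path_edges vs \<inter> path_edges ws \<noteq> {}}"
  let ?g = "\<lambda>(vs, ws). set vs \<union> set ws" and ?h = "\<lambda>(vs, ws). p ^ card (path_edges vs \<union> path_edges ws)"
  let ?T = "{W. W \<subseteq> {1..n} \<and> card W \<in> {1..2 * k + 1}}"
  define B where "B = (\<Sum>i\<le>Suc k. (2 * k + 1) ^ i)"
  have finS: "finite ?S" by (rule finite_subset[of _ "all_paths n k \<times> all_paths n k"]) auto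
  have common: "set vs \<inter> set ws \<noteq> {}" if "path_edges vs \<inter> path_edges ws \<noteq> {}" "vs \<in> all_paths n k" for vs ws
  proof -
    from that obtain e where e: "e \<in> path_edges vs" "e \<in> path_edges ws" by blast
    then have "e \<in> node_pairs n" using that all_paths_edges by blast
    then have "e \<noteq> {}" by (auto simp: node_pairs_def)
    then show ?thesis using path_edges_subset[OF e(1)] path_edges_subset[OF e(2)] by blast
  qed
  have gST: "?g ` ?S \<subseteq> ?T"
  proof clarify
    fix vs ws assume vw: "vs \<in> all_paths n k" "ws \<in> all_paths n k" "path_edges vs \<inter> path_edges ws \<noteq> {}"
    \<comment> \<open>Each path has at most \<open>Suc k\<close> vertices and one of them is shared,
      whence the bound \<open>2 * k + 1\<close>.\<close>
    have "card (set vs \<inter> set ws) \<ge> 1" using common[OF vw(3,1)]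
      by (simp add: Suc_le_eq card_gt_0_iff)
    moreover have "card (set vs \<union> set ws) + card (set vs \<inter> set ws) = length vs + length ws"
      using vw card_Un_Int[of "set vs" "set ws"] by (simp add: all_paths_def distinct_card)
    moreover have "card (set vs \<union> set ws) \<ge> 1" using vw
      by (auto simp: Suc_le_eq card_gt_0_iff all_paths_def)
    ultimately show "set vs \<union> set ws \<subseteq> {1..n} \<and> card (set vs \<union> set ws) \<in> {1..2 * k + 1}"
      using vw by (auto simp: all_paths_def)
  qed
  have "sum ?h ?S = (\<Sum>W\<in>?T. sum ?h {u \<in> ?S. ?g u = W})"
    by (rule sum.group[symmetric]) (use finS gST in auto)
  also have "\<dots> \<le> (\<Sum>W\<in>?T. real B ^ 2 * p ^ (card W - 1))"
  proof (intro sum_mono)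
    fix W assume W: "W \<in> ?T"
    then have finW: "finite W" by (auto intro: finite_subset)
    let ?L = "{xs. set xs \<subseteq> W \<and> length xs \<le> Suc k}"
    have "card ?L = (\<Sum>i\<le>Suc k. card W ^ i)"
      by (rule card_lists_length_le[OF finW])
    also have "\<dots> \<le> B" unfolding B_def using W by (intro sum_mono power_mono) auto
    finally have cL: "card ?L \<le> B" .
    have "{u \<in> ?S. ?g u = W} \<subseteq> ?L \<times> ?L" by (auto simp: all_paths_def)
    then have "card {u \<in> ?S. ?g u = W} \<le> card (?L \<times> ?L)"
      by (intro card_mono finite_cartesian_product finite_lists_length_le finW)
    also have "\<dots> \<le> B ^ 2" using cL by (simp add: card_cartesian_product power2_eq_square mult_mono)
    finally have cS: "card {u \<in> ?S. ?g u = W} \<le> B ^ 2" .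
    have "sum ?h {u \<in> ?S. ?g u = W} \<le> (\<Sum>u\<in>{u \<in> ?S. ?g u = W}. p ^ (card W - 1))"
    proof (intro sum_mono, clarify)
      fix vs ws assume vw: "vs \<in> all_paths n k" "ws \<in> all_paths n k" "path_edges vs \<inter> path_edges ws \<noteq> {}"
      then have "card (set vs \<union> set ws) \<le> Suc (card (path_edges vs \<union> path_edges ws))"
        using common by (intro card_vertices_le) (auto simp: all_paths_def)
      then show "p ^ card (path_edges vs \<union> path_edges ws) \<le> p ^ (card (set vs \<union> set ws) - 1)"
        using p by (intro power_decreasing) auto
    qed
    also have "\<dots> = real (card {u \<in> ?S. ?g u = W}) * p ^ (card W - 1)" by simp
    also have "\<dots> \<le> real (B ^ 2) * p ^ (card W - 1)"
      using cS p by (intro mult_right_mono) auto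
    finally show "sum ?h {u \<in> ?S. ?g u = W} \<le> real B ^ 2 * p ^ (card W - 1)" by simp
  qed
  also have "\<dots> = real B ^ 2 * (\<Sum>W\<in>?T. p ^ (card W - 1))"
    by (simp add: sum_distrib_left)
  also have "(\<Sum>W\<in>?T. p ^ (card W - 1)) = (\<Sum>c=1..2*k+1. \<Sum>W | W \<in> ?T \<and> card W = c. p ^ (card W - 1))"
    by (rule sum.group[symmetric]) auto
  also have "\<dots> \<le> (\<Sum>c=1..2*k+1. real n ^ c * p ^ (c - 1))"
  proof (intro sum_mono)
    fix c assume "c \<in> {1..2 * k + 1}"
    have "card {W. W \<in> ?T \<and> card W = c} \<le> card {W. W \<subseteq> {1..n} \<and> card W = c}"
      by (intro card_mono) auto
    also have "\<dots> \<le> n ^ c" by (cases "c \<le> n") (auto simp: n_subsets binomial_le_pow binomial_eq_0)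
    finally have "real (card {W. W \<in> ?T \<and> card W = c}) \<le> real (n ^ c)"
      by (simp only: of_nat_le_iff)
    then have "real (card {W. W \<in> ?T \<and> card W = c}) * p ^ (c - 1) \<le> real n ^ c * p ^ (c - 1)"
      using p by (intro mult_right_mono) auto
    then show "(\<Sum>W | W \<in> ?T \<and> card W = c. p ^ (card W - 1)) \<le> real n ^ c * p ^ (c - 1)" by simp
  qed
  finally show ?thesis
    unfolding overlap_bound_def B_def[symmetric] by (simp add: mult_left_mono)
qed

section \<open>Truncated distances and the linear program\<close>

lemma Min_Max_doubleton:
  fixes i j :: nat
  assumes "i < j"
  shows "Min {i, j} = i" "Max {i, j} = j"
  using assms by auto

lemma node_pairs_eqI:
  assumes "e \<in> node_pairs n" "e' \<in> node_pairs n" "Min e = Min e'" "Max e = Max e'"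
  shows "e = e'"
  using assms by (elim node_pairsE) (simp add: Min_Max_doubleton)

text \<open>Harris' inequality bounds the expected number of linked pairs, uniformly over rates at
  most \<open>p\<close>, and the covariance bounds from \<open>event_prob_conj_le\<close> add up to
  at most \<open>overlap_bound\<close>.\<close>

lemma linked_tail:
  fixes r :: "nat set \<Rightarrow> real"
  assumes r: "\<forall>e\<in>node_pairs n. r e \<in> {0..p}" and p: "0 \<le> p" "p \<le> 1" and t: "t > 0"
  shows "event_prob (node_pairs n) r (\<lambda>E. real (card {e \<in> node_pairs n. linked n k E e})
      \<ge> real (n choose 2) * (1 - (\<Prod>m=1..k. (1 - p ^ m) ^ (n ^ (m - 1)))) + t) \<le> overlap_bound n k p / t\<^sup>2"
proof -
  let ?A = "node_pairs n"
  define I where "I = (\<lambda>(e, e'). {(vs, ws). (vs, ws) \<in> paths n k e \<times> paths n k e' \<and> path_edges vs \<inter> path_edges ws \<noteq> {}})"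
  let ?f = "\<lambda>(vs, ws). prod r (path_edges vs \<union> path_edges ws)"
  define \<delta> where "\<delta> e e' = sum ?f (I (e, e'))" for e e'
  have r1: "\<forall>e\<in>?A. r e \<in> {0..1}" using r p by fastforce
  have edges: "path_edges vs \<subseteq> ?A" if "vs \<in> paths n k e" for vs e
    using that by (auto simp: paths_def dest: all_paths_edges)
  have prob: "event_prob ?A r (\<lambda>E. linked n k E e) \<le> 1 - (\<Prod>m=1..k. (1 - p ^ m) ^ (n ^ (m - 1)))" for e
  proof -
    have "(\<Prod>m=1..k. (1 - p ^ m) ^ (n ^ (m - 1))) \<le> (\<Prod>vs\<in>paths n k e. 1 - prod r (path_edges vs))"
      using r p by (intro prod_paths_ge) auto
    also have "\<dots> \<le> event_prob ?A r (\<lambda>E. \<forall>vs\<in>paths n k e. \<not> path_edges vs \<subseteq> E)"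
      by (rule event_prob_avoid_ge) (use r1 edges in auto)
    also have "\<dots> = event_prob ?A r (\<lambda>E. \<not> linked n k E e)"
      by (simp add: linked_def)
    also have "\<dots> = 1 - event_prob ?A r (\<lambda>E. linked n k E e)"
      by (rule event_prob_not) simp
    finally show ?thesis by simp
  qed
  have cov: "event_prob ?A r (\<lambda>E. linked n k E e \<and> linked n k E e') \<le>
     event_prob ?A r (\<lambda>E. linked n k E e) * event_prob ?A r (\<lambda>E. linked n k E e') + \<delta> e e'" for e e'
    unfolding linked_def \<delta>_def I_def prod.case
    by (rule event_prob_conj_le[OF finite_node_pairs r1 finite_paths finite_paths]) (use edges in blast)
  have finI: "finite (I q)" for q
    by (rule finite_subset[of _ "paths n k (fst q) \<times> paths n k (snd q)"]) (auto simp: I_def)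
  have "(\<Sum>e\<in>?A. \<Sum>e'\<in>?A. \<delta> e e') = (\<Sum>q\<in>?A \<times> ?A. sum ?f (I q))"
    by (simp add: \<delta>_def sum.cartesian_product)
  also have "\<dots> = sum ?f (\<Union>q\<in>?A \<times> ?A. I q)"
  \<comment> \<open>The ends of a path determine its node pair, so the index sets of different
    \<open>(e, e')\<close> are disjoint and the double sum becomes a single sum over pairs of
    paths.\<close>
  proof (rule sum.UNION_disjoint[symmetric])
    show "\<forall>q\<in>?A \<times> ?A. \<forall>q'\<in>?A \<times> ?A. q \<noteq> q' \<longrightarrow> I q \<inter> I q' = {}"
    proof (intro ballI impI)
      fix q q' assume q: "q \<in> ?A \<times> ?A" "q' \<in> ?A \<times> ?A" "q \<noteq> q'"
      have "e = e'" if "vs \<in> paths n k e" "vs \<in> paths n k e'" "e \<in> ?A" "e' \<in> ?A" for vs e e'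
        using that by (intro node_pairs_eqI[of e n e']) (auto simp: paths_def)
      note eq = this
      show "I q \<inter> I q' = {}"
      proof (rule ccontr)
        assume "I q \<inter> I q' \<noteq> {}"
        then obtain vs ws where "(vs, ws) \<in> I q" "(vs, ws) \<in> I q'" by auto
        then have "vs \<in> paths n k (fst q)" "vs \<in> paths n k (fst q')"
            "ws \<in> paths n k (snd q)" "ws \<in> paths n k (snd q')"
          by (simp_all add: I_def case_prod_unfold)
        then have "fst q = fst q'" "snd q = snd q'"
          using q eq by (metis mem_Times_iff)+
        then show False using q(3) by (simp add: prod_eq_iff)
      qed
    qed
  qed (use finI in auto)
  also have "\<dots> \<le> sum ?f {(vs, ws). (vs, ws) \<in> all_paths n k \<times> all_paths n k \<and> path_edges vs \<inter> path_edges ws \<noteq> {}}"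
  proof (intro sum_mono2)
    show "finite {(vs, ws). (vs, ws) \<in> all_paths n k \<times> all_paths n k \<and> path_edges vs \<inter> path_edges ws \<noteq> {}}"
      by (rule finite_subset[of _ "all_paths n k \<times> all_paths n k"]) auto
    show "0 \<le> ?f u" if "u \<in> {(vs, ws). (vs, ws) \<in> all_paths n k \<times> all_paths n k \<and> path_edges vs \<inter> path_edges ws \<noteq> {}}
        - (\<Union>q\<in>?A \<times> ?A. I q)" for u
    proof -
      obtain vs ws where u: "u = (vs, ws)" by (cases u)
      then have "path_edges vs \<subseteq> ?A" "path_edges ws \<subseteq> ?A" using that all_paths_edges by auto
      then have "0 \<le> r e" if "e \<in> path_edges vs \<union> path_edges ws" for e
        using that r1 by auto
      then show ?thesis unfolding u prod.case by (intro prod_nonneg) auto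
    qed
  qed (auto simp: I_def paths_def)
  also have "\<dots> \<le> (\<Sum>(vs, ws) | (vs, ws) \<in> all_paths n k \<times> all_paths n k \<and> path_edges vs \<inter> path_edges ws \<noteq> {}.
      p ^ card (path_edges vs \<union> path_edges ws))"
  proof (intro sum_mono, clarify)
    fix vs ws assume "vs \<in> all_paths n k" "ws \<in> all_paths n k"
    then have "path_edges vs \<union> path_edges ws \<subseteq> ?A" by (simp add: all_paths_edges)
    then have "prod r (path_edges vs \<union> path_edges ws) \<le> (\<Prod>e\<in>path_edges vs \<union> path_edges ws. p)"
      using r by (intro prod_mono) auto
    then show "prod r (path_edges vs \<union> path_edges ws) \<le> p ^ card (path_edges vs \<union> path_edges ws)" by simp
  qed
  also have "\<dots> \<le> overlap_bound n k p" by (rule sum_overlap_le[OF p])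
  finally have D: "(\<Sum>e\<in>?A. \<Sum>e'\<in>?A. \<delta> e e') \<le> overlap_bound n k p" .
  let ?\<mu> = "\<Sum>e\<in>?A. event_prob ?A r (\<lambda>E. linked n k E e)"
  have "?\<mu> \<le> (\<Sum>e\<in>?A. 1 - (\<Prod>m=1..k. (1 - p ^ m) ^ (n ^ (m - 1))))"
    by (intro sum_mono prob)
  then have mu: "?\<mu> \<le> real (n choose 2) * (1 - (\<Prod>m=1..k. (1 - p ^ m) ^ (n ^ (m - 1))))"
    by (simp add: card_node_pairs)
  have "event_prob ?A r (\<lambda>E. real (card {e \<in> node_pairs n. linked n k E e})
      \<ge> real (n choose 2) * (1 - (\<Prod>m=1..k. (1 - p ^ m) ^ (n ^ (m - 1)))) + t)
    \<le> event_prob ?A r (\<lambda>E. \<bar>real (card {e \<in> ?A. linked n k E e}) - ?\<mu>\<bar> \<ge> t)"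
    using mu by (intro event_prob_mono) auto
  also have "\<dots> \<le> (\<Sum>e\<in>?A. \<Sum>e'\<in>?A. \<delta> e e') / t\<^sup>2"
    by (rule count_deviation) (use t cov in auto)
  also have "\<dots> \<le> overlap_bound n k p / t\<^sup>2"
    using D t by (intro divide_right_mono) auto
  finally show ?thesis .
qed

section \<open>The truncated graph distance and the feasible point built from it\<close>

definition adj :: "nat set set \<Rightarrow> (nat \<times> nat) set" where
  "adj E = {(i, j). {i, j} \<in> E}"

text \<open>Defined by walks, as powers of the adjacency relation, because walks concatenate. The
  power with exponent zero is the identity, so the diagonal gets the value zero.\<close>

definition tdist :: "nat \<Rightarrow> real \<Rightarrow> nat set set \<Rightarrow> nat \<Rightarrow> nat \<Rightarrow> real" where
  "tdist d T E i j = (if \<exists>m\<le>d. (i, j) \<in> adj E ^^ m then real (LEAST m. (i, j) \<in> adj E ^^ m) else T)"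

lemma tdist_nonneg: "0 \<le> T \<Longrightarrow> 0 \<le> tdist d T E i j"
  by (simp add: tdist_def)

lemma tdist_le_steps:
  assumes "(i, j) \<in> adj E ^^ m" "m \<le> d"
  shows "tdist d T E i j \<le> real m"
  using assms by (auto simp: tdist_def intro: Least_le)

lemma tdist_cases:
  obtains (far) "tdist d T E i j = T" "\<nexists>m. m \<le> d \<and> (i, j) \<in> adj E ^^ m"
  | (near) m where "m \<le> d" "(i, j) \<in> adj E ^^ m" "tdist d T E i j = real m"
proof (cases "\<exists>m\<le>d. (i, j) \<in> adj E ^^ m")
  case True
  then obtain m where m: "m \<le> d" "(i, j) \<in> adj E ^^ m" by blast
  let ?l = "LEAST m. (i, j) \<in> adj E ^^ m"
  have "?l \<le> d" using Least_le[of "\<lambda>m. (i, j) \<in> adj E ^^ m", OF m(2)] m(1) by linarith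
  moreover have "(i, j) \<in> adj E ^^ ?l" using m(2) by (rule LeastI)
  ultimately show thesis using True near[of ?l] by (simp add: tdist_def)
next
  case False
  then show thesis using far by (auto simp: tdist_def)
qed

lemma tdist_le: "real d \<le> T \<Longrightarrow> tdist d T E i j \<le> T"
  by (rule tdist_cases[of d T E i j]) auto

lemma adj_relpow_sym: "(i, j) \<in> adj E ^^ m \<Longrightarrow> (j, i) \<in> adj E ^^ m"
proof (induction m arbitrary: j)
  case (Suc m)
  then obtain k where "(i, k) \<in> adj E ^^ m" "(k, j) \<in> adj E" by auto
  then have "(k, i) \<in> adj E ^^ m" "(j, k) \<in> adj E"
    using Suc.IH by (auto simp: adj_def insert_commute)
  then show ?case by (metis relpow_Suc_I2)
qed auto

lemma tdist_sym: "tdist d T E i j = tdist d T E j i"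
proof -
  have "(i, j) \<in> adj E ^^ m \<longleftrightarrow> (j, i) \<in> adj E ^^ m" for m
    using adj_relpow_sym by blast
  then show ?thesis by (auto simp: tdist_def)
qed

text \<open>If both legs are short, then either their concatenation has length at most
  \<open>d\<close>, or their lengths add up to at least \<open>d + 1\<close>, which is at least
  \<open>T\<close>. A leg beyond distance \<open>d\<close> already has the maximal value
  \<open>T\<close>.\<close>

lemma tdist_triangle:
  assumes "real d \<le> T" "T \<le> real d + 1"
  shows "tdist d T E i j \<le> tdist d T E i k + tdist d T E k j"
proof -
  have T: "0 \<le> T" using assms by linarith
  show ?thesis
  proof (cases rule: tdist_cases[of d T E i k])
    case far
    then show ?thesis using tdist_le[OF assms(1), of E i j] tdist_nonneg[OF T, of d E k j] by linarith
  next
    case (near m)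
    note m = near
    show ?thesis
    proof (cases rule: tdist_cases[of d T E k j])
      case far
      then show ?thesis using tdist_le[OF assms(1), of E i j] tdist_nonneg[OF T, of d E i k] by linarith
    next
      case (near l)
      have walk: "(i, j) \<in> adj E ^^ (m + l)"
        using m near by (auto simp: relpow_add)
      show ?thesis
      proof (cases "m + l \<le> d")
        case True
        then show ?thesis using tdist_le_steps[OF walk True, of T] m near by simp
      next
        case False
        then have "real d + 1 \<le> real m + real l" by linarith
        then show ?thesis using tdist_le[OF assms(1), of E i j] assms(2) m near by linarith
      qed
    qed
  qed
qed

text \<open>Loop erasure: if the next vertex already occurs on the path, the path is cut at that
  occurrence.\<close>

lemma relpow_path:
  assumes E: "E \<subseteq> node_pairs n" and i: "i \<in> {1..n}"
  shows "(i, j) \<in> adj E ^^ m \<Longrightarrow> \<exists>vs. vs \<noteq> [] \<and> distinct vs \<and> set vs \<subseteq> {1..n} \<and> hd vs = i \<and> last vs = j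
           \<and> length vs \<le> Suc m \<and> path_edges vs \<subseteq> E"
proof (induction m arbitrary: j)
  case 0
  then show ?case using i by (intro exI[of _ "[i]"]) auto
next
  case (Suc m)
  then obtain k where k: "(i, k) \<in> adj E ^^ m" "{k, j} \<in> E" by (auto simp: adj_def)
  from Suc.IH[OF k(1)] obtain vs where vs: "vs \<noteq> []" "distinct vs" "set vs \<subseteq> {1..n}" "hd vs = i"
    "last vs = k" "length vs \<le> Suc m" "path_edges vs \<subseteq> E" by blast
  show ?case
  proof (cases "j \<in> set vs")
    case False
    have "j \<in> {1..n}" using k(2) E doubleton_in_node_pairs by blast
    then show ?thesis using False vs k(2)
      by (intro exI[of _ "vs @ [j]"]) (auto simp: path_edges_snoc)
  next
    case True
    then obtain us ws where uw: "vs = (us @ [j]) @ ws" by (metis append.assoc append_Cons append_Nil split_list)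
    have "path_edges (us @ [j]) \<subseteq> E" using vs(7) path_edges_append[of "us @ [j]" ws] uw by auto
    moreover have "hd (us @ [j]) = i" using vs(4) uw by (cases us) auto
    ultimately show ?thesis using vs uw by (intro exI[of _ "us @ [j]"]) auto
  qed
qed

lemma linked_if_relpow:
  assumes "E \<subseteq> node_pairs n" "i \<in> {1..n}" "i < j" "(i, j) \<in> adj E ^^ m" "m \<le> k"
  shows "linked n k E {i, j}"
proof -
  from relpow_path[OF assms(1,2,4)] obtain vs where vs: "vs \<noteq> []" "distinct vs" "set vs \<subseteq> {1..n}"
    "hd vs = i" "last vs = j" "length vs \<le> Suc m" "path_edges vs \<subseteq> E" by blast
  moreover have "2 \<le> length vs"
    using vs assms(3) by (cases vs rule: path_edges.cases) auto
  ultimately have "vs \<in> paths n k {i, j}"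
    using assms by (auto simp: paths_def all_paths_def)
  then show ?thesis using vs by (auto simp: linked_def)
qed

text \<open>A pair at distance exactly \<open>d\<close> accounts for \<open>d\<close>, a farther one
  for \<open>d + (T - d)\<close>, and nearer pairs are estimated by zero.\<close>

lemma sum_tdist_ge:
  assumes E: "E \<subseteq> node_pairs n" and T: "real d \<le> T" and d: "1 \<le> d"
  shows "(\<Sum>e\<in>node_pairs n. tdist d T E (Min e) (Max e)) \<ge>
    real d * (real (n choose 2) - real (card {e \<in> node_pairs n. linked n (d - 1) E e}))
    + (T - real d) * (real (n choose 2) - real (card {e \<in> node_pairs n. linked n d E e}))"
proof -
  let ?A = "node_pairs n"
  have far: "real (card {e \<in> ?A. \<not> linked n k E e}) = real (n choose 2) - real (card {e \<in> ?A. linked n k E e})" for k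
  proof -
    have "{e \<in> ?A. \<not> linked n k E e} = ?A - {e \<in> ?A. linked n k E e}" by auto
    then show ?thesis
      by (simp add: card_Diff_subset card_node_pairs[symmetric] of_nat_diff card_mono)
  qed
  have "real d * (real (n choose 2) - real (card {e \<in> ?A. linked n (d - 1) E e}))
    + (T - real d) * (real (n choose 2) - real (card {e \<in> ?A. linked n d E e}))
    = (\<Sum>e\<in>?A. real d * of_bool (\<not> linked n (d - 1) E e) + (T - real d) * of_bool (\<not> linked n d E e))"
    by (simp add: far[symmetric] sum.distrib sum_distrib_left[symmetric] Int_def)
  also have "\<dots> \<le> (\<Sum>e\<in>?A. tdist d T E (Min e) (Max e))"
  proof (rule sum_mono)
    fix e assume "e \<in> ?A"
    then obtain i j where e: "e = {i, j}" "i \<in> {1..n}" "j \<in> {1..n}" "i < j" by (rule node_pairsE)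
    note lk = linked_if_relpow[OF E e(2,4)]
    show "real d * of_bool (\<not> linked n (d - 1) E e) + (T - real d) * of_bool (\<not> linked n d E e) \<le> tdist d T E (Min e) (Max e)"
    proof (cases rule: tdist_cases[of d T E i j])
      case far
      then show ?thesis using T by (auto simp: e(1) Min_Max_doubleton[OF e(4)] of_bool_def)
    next
      case (near m)
      have "linked n d E {i, j}" using lk near by blast
      moreover have "linked n (d - 1) E {i, j}" if "m \<noteq> d"
        using lk near that by (metis Nat.le_diff_conv2 Suc_eq_plus1 Suc_leI d le_neq_implies_less)
      ultimately show ?thesis using near by (auto simp: e(1) Min_Max_doubleton[OF e(4)] of_bool_def)
    qed
  qed
  finally show ?thesis .
qed

text \<open>The deterministic part. For the scaling factor \<open>c = n^2 / (4 * K)\<close>, the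
  lower bound on \<open>K\<close> says \<open>3 * T * c \<le> 2\<close>, and \<open>cheap\<close>
  says that \<open>c\<close> times the number of edges is less than the number of edges
  across.\<close>

lemma not_lp_recovers:
  assumes E: "E \<subseteq> node_pairs n" and T: "real d \<le> T" "T \<le> real d + 1" and d: "1 \<le> d" and n: "0 < n"
    and K: "K = (\<Sum>e\<in>node_pairs n. tdist d T E (Min e) (Max e))" "3 * T / 8 * (real n)\<^sup>2 \<le> K"
    and cheap: "real (card E) * (real n)\<^sup>2 < 4 * K * real (card {e \<in> E. \<not> same_part P e})"
  shows "\<not> lp_recovers n P E"
proof -
  let ?A = "node_pairs n" and ?\<rho> = "tdist d T E"
  have T1: "1 \<le> T" using T d by linarith
  have "0 < 3 * T / 8 * (real n)\<^sup>2" using T1 n by simp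
  then have K0: "0 < K" using K(2) by linarith
  define c where "c = (real n)\<^sup>2 / (4 * K)"
  have c: "0 \<le> c" "3 * T * c \<le> 2" using K0 K(2) by (auto simp: c_def field_simps)
  define y where "y = (\<lambda>e\<in>?A. c * ?\<rho> (Min e) (Max e))"
  have y: "y {i, j} = c * ?\<rho> i j" if ij: "i \<in> {1..n}" "j \<in> {1..n}" "i \<noteq> j" for i j
  proof (cases "i < j")
    case True
    then show ?thesis using ij doubleton_in_node_pairs[of i j n] by (simp add: y_def Min_Max_doubleton)
  next
    case False
    then have "j < i" using ij by simp
    then show ?thesis using ij doubleton_in_node_pairs[of j i n] Min_Max_doubleton[of j i] tdist_sym[of d T E j i]
      by (simp add: y_def insert_commute)
  qed
  have feas: "lp_feasible n y"
    unfolding lp_feasible_def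
  proof (intro conjI ballI impI)
    show "y \<in> extensional ?A" by (simp add: y_def)
  next
    fix i j k assume ijk: "i \<in> {1..n}" "j \<in> {1..n}" "k \<in> {1..n}" "i < j \<and> k \<noteq> i \<and> k \<noteq> j"
    have "c * ?\<rho> i j \<le> c * (?\<rho> i k + ?\<rho> k j)"
      using c tdist_triangle[OF T] by (intro mult_left_mono) auto
    then show "y {i, j} \<le> y {i, k} + y {j, k}"
      using ijk by (simp add: y tdist_sym[of d T E j k] distrib_left)
  next
    fix i j k assume ijk: "i \<in> {1..n}" "j \<in> {1..n}" "k \<in> {1..n}" "i < j \<and> j < k"
    have "c * (?\<rho> i j + ?\<rho> i k + ?\<rho> j k) \<le> c * (T + T + T)"
      using c tdist_le[OF T(1)] by (intro mult_left_mono add_mono) auto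
    moreover have "c * (T + T + T) \<le> 2" using c by (simp add: algebra_simps)
    ultimately show "y {i, j} + y {i, k} + y {j, k} \<le> 2"
      using ijk by (simp add: y distrib_left)
  next
    have "(\<Sum>e\<in>?A. y e) = c * K" by (simp add: y_def K(1) sum_distrib_left)
    then show "(\<Sum>e\<in>?A. y e) = (real n)\<^sup>2 / 4" using K0 by (simp add: c_def)
  qed
  have obj: "lp_objective n E x = (\<Sum>e\<in>E. x e)" for x
  proof -
    have "lp_objective n E x = (\<Sum>e\<in>?A. if e \<in> E then x e else 0)"
      unfolding lp_objective_def by (intro sum.cong) auto
    also have "\<dots> = (\<Sum>e\<in>?A \<inter> E. x e)" by (simp add: sum.inter_restrict)
    also have "?A \<inter> E = E" using E by blast
    finally show ?thesis .
  qed
  have finE: "finite E" using finite_subset[OF E] by simp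
  have "lp_objective n E y \<le> (\<Sum>e\<in>E. c)"
    unfolding obj
  proof (rule sum_mono)
    fix e assume e: "e \<in> E"
    then obtain i j where ij: "e = {i, j}" "i \<in> {1..n}" "j \<in> {1..n}" "i < j" using E node_pairsE by blast
    \<comment> \<open>An edge is a walk of length one, and \<open>1 \<le> d\<close>, so truncation
      does not affect it.\<close>
    have "?\<rho> i j \<le> 1"
      using tdist_le_steps[of i j 1 E d T] e ij d by (simp add: adj_def)
    then have "c * ?\<rho> i j \<le> c * 1" using c by (intro mult_left_mono)
    then show "y e \<le> c" using ij y[of i j] by simp
  qed
  also have "\<dots> < real (card {e \<in> E. \<not> same_part P e})"
    using cheap K0 by (simp add: c_def field_simps)
  also have "\<dots> = lp_objective n E (cut_vector n P)"
  proof -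
    have "lp_objective n E (cut_vector n P) = (\<Sum>e\<in>E. of_bool (\<not> same_part P e))"
      unfolding obj using E by (intro sum.cong) (auto simp: cut_vector_def)
    then show ?thesis using finE by (simp add: Int_def)
  qed
  finally have "lp_objective n E y < lp_objective n E (cut_vector n P)" .
  then have "\<not> lp_optimal n E (cut_vector n P)"
    using feas by (auto simp: lp_optimal_def is_arg_min_def)
  then show ?thesis by (simp add: lp_recovers_def)
qed

section \<open>Asymptotics\<close>

lemma finite_bisections [simp]: "finite (bisections n)"
proof (rule finite_subset)
  show "bisections n \<subseteq> Pow (Pow {1..n})"
    by (auto simp: bisections_def partition_on_def)
qed simp

lemma bisections_nonempty:
  assumes "even n" "0 < n"
  shows "bisections n \<noteq> {}"
proof -
  obtain m where m: "n = 2 * m" using assms by auto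
  let ?A = "{1..m}" and ?B = "{m + 1..n}"
  have "m \<ge> 1" using assms m by simp
  then have ne: "?A \<noteq> ?B" by auto
  have "?A \<union> ?B = {1..n}" using m by auto
  then have "partition_on {1..n} {?A, ?B}"
    using m assms by (auto simp: partition_on_def disjoint_def)
  then have "{?A, ?B} \<in> bisections n"
    using m ne by (simp add: bisections_def card_insert_if)
  then show ?thesis by auto
qed

text \<open>The pairs across correspond to the elements of \<open>A \<times> B\<close>, and each
  part has half of the nodes.\<close>

lemma card_cross_pairs:
  assumes P: "P \<in> bisections n"
  shows "4 * card {e \<in> node_pairs n. \<not> same_part P e} = n\<^sup>2"
proof -
  from P obtain A B where AB: "P = {A, B}" "A \<noteq> B"
    by (auto simp: bisections_def card_2_iff)
  with P have part: "A \<union> B = {1..n}" "A \<inter> B = {}" and c: "2 * card A = n" "2 * card B = n"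
    by (auto simp: bisections_def partition_on_def disjoint_def)
  have fin: "finite A" "finite B" using part by (metis finite_Un finite_atLeastAtMost)+
  have "{e \<in> node_pairs n. \<not> same_part P e} = (\<lambda>(a, b). {a, b}) ` (A \<times> B)"
  proof (intro equalityI subsetI)
    fix e assume "e \<in> {e \<in> node_pairs n. \<not> same_part P e}"
    then have e: "e \<in> node_pairs n" "\<not> e \<subseteq> A" "\<not> e \<subseteq> B" by (auto simp: same_part_def AB)
    from e(1) obtain i j where ij: "e = {i, j}" "i \<in> A \<union> B" "j \<in> A \<union> B"
      by (rule node_pairsE) (simp add: part)
    then have "(i, j) \<in> A \<times> B \<or> (j, i) \<in> A \<times> B" using e by auto
    then show "e \<in> (\<lambda>(a, b). {a, b}) ` (A \<times> B)" using ij(1) by (auto simp: insert_commute)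
  next
    fix e assume "e \<in> (\<lambda>(a, b). {a, b}) ` (A \<times> B)"
    then obtain a b where ab: "e = {a, b}" "a \<in> A" "b \<in> B" by auto
    then have "a \<noteq> b" "a \<in> {1..n}" "b \<in> {1..n}" "b \<notin> A" "a \<notin> B" using part by auto
    then show "e \<in> {e \<in> node_pairs n. \<not> same_part P e}"
      using ab by (auto simp: same_part_def AB doubleton_in_node_pairs)
  qed
  also have "card \<dots> = card (A \<times> B)"
  proof (rule card_image, rule inj_onI, clarify)
    fix a b a' b' assume "a \<in> A" "b \<in> B" "a' \<in> A" "b' \<in> B" "{a, b} = {a', b'}"
    then show "a = a' \<and> b = b'" using part(2) by (auto simp: doubleton_eq_iff)
  qed
  also have "4 * \<dots> = n\<^sup>2"
    using c by (simp add: card_cartesian_product power2_eq_square) (metis mult.assoc mult.left_commute numeral_Bit0 mult_2)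
  finally show ?thesis .
qed

section \<open>High probability, uniformly over the planted bisection\<close>

abbreviation evens :: "nat filter" where
  "evens \<equiv> inf sequentially (principal {n. even n})"

lemma eventually_evensI:
  assumes "eventually P sequentially"
  shows "eventually P evens"
  using assms by (rule filter_leD[OF inf_le1])

lemma eventually_evens_even: "eventually (\<lambda>n. even n) evens"
  by (simp add: eventually_inf_principal)

definition rate :: "real \<Rightarrow> real \<Rightarrow> real \<Rightarrow> nat \<Rightarrow> nat set set \<Rightarrow> nat set \<Rightarrow> real" where
  "rate \<alpha> \<beta> \<omega> n P e = (if same_part P e then \<alpha> * real n powr (- \<omega>) else \<beta> * real n powr (- \<omega>))"

text \<open>Uniformity over the planted bisection \<open>P\<close> allows one to condition on \<open>P\<close>, which leaves
  independent edges.\<close>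

definition whp :: "real \<Rightarrow> real \<Rightarrow> real \<Rightarrow> (nat \<Rightarrow> nat set set \<Rightarrow> nat set set \<Rightarrow> bool) \<Rightarrow> bool" where
  "whp \<alpha> \<beta> \<omega> \<phi> \<longleftrightarrow> (\<forall>\<epsilon>>0. eventually (\<lambda>n. \<forall>P\<in>bisections n.
      event_prob (node_pairs n) (rate \<alpha> \<beta> \<omega> n P) (\<lambda>E. \<not> \<phi> n P E) \<le> \<epsilon>) evens)"

lemma whpI:
  assumes "eventually (\<lambda>n. \<forall>P\<in>bisections n.
      event_prob (node_pairs n) (rate \<alpha> \<beta> \<omega> n P) (\<lambda>E. \<not> \<phi> n P E) \<le> f n) sequentially"
    and "f \<longlonglongrightarrow> 0"
  shows "whp \<alpha> \<beta> \<omega> \<phi>"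
  unfolding whp_def
proof (intro allI impI)
  fix \<epsilon> :: real assume "\<epsilon> > 0"
  with assms(2) have "eventually (\<lambda>n. f n < \<epsilon>) sequentially" by (rule order_tendstoD)
  with assms(1) have "eventually (\<lambda>n. \<forall>P\<in>bisections n.
      event_prob (node_pairs n) (rate \<alpha> \<beta> \<omega> n P) (\<lambda>E. \<not> \<phi> n P E) \<le> \<epsilon>) sequentially"
    by eventually_elim (meson less_imp_le order_trans)
  then show "eventually (\<lambda>n. \<forall>P\<in>bisections n.
      event_prob (node_pairs n) (rate \<alpha> \<beta> \<omega> n P) (\<lambda>E. \<not> \<phi> n P E) \<le> \<epsilon>) evens"
    by (rule eventually_evensI)
qed

lemma whp_conj:
  assumes "whp \<alpha> \<beta> \<omega> \<phi>" "whp \<alpha> \<beta> \<omega> \<psi>"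
  shows "whp \<alpha> \<beta> \<omega> (\<lambda>n P E. \<phi> n P E \<and> \<psi> n P E)"
  unfolding whp_def
proof (intro allI impI)
  fix \<epsilon> :: real assume "\<epsilon> > 0"
  then have "\<epsilon> / 2 > 0" by simp
  with assms have "eventually (\<lambda>n. \<forall>P\<in>bisections n.
      event_prob (node_pairs n) (rate \<alpha> \<beta> \<omega> n P) (\<lambda>E. \<not> \<phi> n P E) \<le> \<epsilon> / 2) evens"
    "eventually (\<lambda>n. \<forall>P\<in>bisections n.
      event_prob (node_pairs n) (rate \<alpha> \<beta> \<omega> n P) (\<lambda>E. \<not> \<psi> n P E) \<le> \<epsilon> / 2) evens"
    unfolding whp_def by blast+
  then show "eventually (\<lambda>n. \<forall>P\<in>bisections n.
      event_prob (node_pairs n) (rate \<alpha> \<beta> \<omega> n P) (\<lambda>E. \<not> (\<phi> n P E \<and> \<psi> n P E)) \<le> \<epsilon>) evens"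
  proof eventually_elim
    case (elim n)
    show ?case
    proof
      fix P assume P: "P \<in> bisections n"
      have "event_prob (node_pairs n) (rate \<alpha> \<beta> \<omega> n P) (\<lambda>E. \<not> \<phi> n P E \<or> \<not> \<psi> n P E)
        \<le> \<epsilon> / 2 + \<epsilon> / 2"
        using elim P by (intro order_trans[OF event_prob_or_le] add_mono) auto
      then show "event_prob (node_pairs n) (rate \<alpha> \<beta> \<omega> n P) (\<lambda>E. \<not> (\<phi> n P E \<and> \<psi> n P E)) \<le> \<epsilon>"
        by simp
    qed
  qed
qed

lemma whp_mono:
  assumes "whp \<alpha> \<beta> \<omega> \<phi>"
    and "eventually (\<lambda>n. \<forall>P\<in>bisections n. \<forall>E. E \<subseteq> node_pairs n \<longrightarrow> \<phi> n P E \<longrightarrow> \<psi> n P E) sequentially"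
  shows "whp \<alpha> \<beta> \<omega> \<psi>"
  unfolding whp_def
proof (intro allI impI)
  fix \<epsilon> :: real assume "\<epsilon> > 0"
  with assms(1) have "eventually (\<lambda>n. \<forall>P\<in>bisections n.
      event_prob (node_pairs n) (rate \<alpha> \<beta> \<omega> n P) (\<lambda>E. \<not> \<phi> n P E) \<le> \<epsilon>) evens"
    unfolding whp_def by blast
  with eventually_evensI[OF assms(2)] show "eventually (\<lambda>n. \<forall>P\<in>bisections n.
      event_prob (node_pairs n) (rate \<alpha> \<beta> \<omega> n P) (\<lambda>E. \<not> \<psi> n P E) \<le> \<epsilon>) evens"
  proof eventually_elim
    case (elim n)
    show ?case
    proof
      fix P assume P: "P \<in> bisections n"
      have "event_prob (node_pairs n) (rate \<alpha> \<beta> \<omega> n P) (\<lambda>E. \<not> \<psi> n P E)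
          \<le> event_prob (node_pairs n) (rate \<alpha> \<beta> \<omega> n P) (\<lambda>E. \<not> \<phi> n P E)"
        using elim(1) P by (intro event_prob_mono) auto
      also have "\<dots> \<le> \<epsilon>" using elim(2) P by blast
      finally show "event_prob (node_pairs n) (rate \<alpha> \<beta> \<omega> n P) (\<lambda>E. \<not> \<psi> n P E) \<le> \<epsilon>" .
    qed
  qed
qed

lemma sbm_edges_eq:
  "sbm_edges n (\<alpha> * real n powr (- \<omega>)) (\<beta> * real n powr (- \<omega>)) P
    = random_subset (node_pairs n) (rate \<alpha> \<beta> \<omega> n P)"
  by (simp add: sbm_edges_def random_subset_def rate_def)

text \<open>The law \<open>sbm\<close> is the uniform mixture over \<open>P\<close> of the laws
  conditioned on \<open>P\<close>, so a bound that is uniform in \<open>P\<close> survives the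
  averaging.\<close>

lemma whp_sbm:
  assumes "whp \<alpha> \<beta> \<omega> \<phi>"
  shows "((\<lambda>n. measure_pmf.prob (sbm n (\<alpha> * real n powr (- \<omega>)) (\<beta> * real n powr (- \<omega>)))
              {(P, E). \<phi> n P E}) \<longlongrightarrow> 1) evens"
proof (rule order_tendstoI)
  fix a :: real assume "a < 1"
  \<comment> \<open>Half of \<open>1 - a\<close>, so that the resulting lower bound
    \<open>1 - (1 - a) / 2\<close> exceeds \<open>a\<close> strictly.\<close>
  then have "(1 - a) / 2 > 0" by simp
  with assms have "eventually (\<lambda>n. \<forall>P\<in>bisections n.
      event_prob (node_pairs n) (rate \<alpha> \<beta> \<omega> n P) (\<lambda>E. \<not> \<phi> n P E) \<le> (1 - a) / 2) evens"
    unfolding whp_def by blast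
  moreover have "eventually (\<lambda>n. 0 < n) evens"
    by (intro eventually_evensI eventually_gt_at_top)
  ultimately show "eventually (\<lambda>n. a < measure_pmf.prob
     (sbm n (\<alpha> * real n powr (- \<omega>)) (\<beta> * real n powr (- \<omega>))) {(P, E). \<phi> n P E}) evens"
    using eventually_evens_even
  proof eventually_elim
    case (elim n)
    let ?S = "{(P, E). \<phi> n P E}" and ?B = "bisections n"
    let ?Q = "\<lambda>P. map_pmf (Pair P) (random_subset (node_pairs n) (rate \<alpha> \<beta> \<omega> n P))"
    have ne: "?B \<noteq> {}" using elim by (intro bisections_nonempty)
    then have cB: "0 < real (card ?B)" by (simp add: card_gt_0_iff)
    have avg: "(\<Sum>P\<in>?B. c /\<^sub>R real (card ?B)) = c" for c :: real
      using cB ne by (simp add: field_simps)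
    have "measure_pmf.prob (sbm n (\<alpha> * real n powr (- \<omega>)) (\<beta> * real n powr (- \<omega>))) ?S
        = measure_pmf.expectation (pmf_of_set ?B \<bind> ?Q) (indicator ?S)"
      by (simp add: sbm_def sbm_edges_eq)
    also have "\<dots> = (\<Sum>P\<in>?B. measure_pmf.expectation (?Q P) (indicator ?S) /\<^sub>R real (card ?B))"
      by (rule pmf_expectation_bind_pmf_of_set) (use ne in \<open>auto simp: finite_set_random_subset\<close>)
    also have "\<dots> \<ge> (\<Sum>P\<in>?B. (1 - (1 - a) / 2) /\<^sub>R real (card ?B))"
    proof (intro sum_mono scaleR_left_mono)
      fix P assume P: "P \<in> ?B"
      have "measure_pmf.expectation (?Q P) (indicator ?S :: _ \<Rightarrow> real)
          = event_prob (node_pairs n) (rate \<alpha> \<beta> \<omega> n P) (\<phi> n P)"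
        by (simp add: event_prob_eq)
      also have "\<dots> = 1 - event_prob (node_pairs n) (rate \<alpha> \<beta> \<omega> n P) (\<lambda>E. \<not> \<phi> n P E)"
        using event_prob_not[of "node_pairs n" "rate \<alpha> \<beta> \<omega> n P" "\<phi> n P"] by simp
      also have "\<dots> \<ge> 1 - (1 - a) / 2" using elim P by simp
      finally show "1 - (1 - a) / 2 \<le> measure_pmf.expectation (?Q P) (indicator ?S)" .
    qed (use cB in simp)
    finally have "1 - (1 - a) / 2 \<le> measure_pmf.prob
        (sbm n (\<alpha> * real n powr (- \<omega>)) (\<beta> * real n powr (- \<omega>))) ?S"
      unfolding avg .
    moreover have "a < 1 - (1 - a) / 2" using \<open>a < 1\<close> by (simp add: field_simps)
    ultimately show ?case by linarith
  qed
next
  fix a :: real assume "1 < a"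
  then show "eventually (\<lambda>n. measure_pmf.prob
     (sbm n (\<alpha> * real n powr (- \<omega>)) (\<beta> * real n powr (- \<omega>))) {(P, E). \<phi> n P E} < a) evens"
    by (intro always_eventually allI order.strict_trans1[OF measure_pmf.prob_le_1])
qed

section \<open>Concentration of the edge counts\<close>

lemma edge_count_deviation:
  assumes A: "finite A" "\<forall>e\<in>A. r e \<in> {0..1}" and J: "J \<subseteq> A" and t: "t > 0"
  shows "event_prob A r (\<lambda>E. \<bar>real (card {e \<in> J. e \<in> E}) - sum r J\<bar> \<ge> t) \<le> sum r J / t\<^sup>2"
proof -
  have fin: "finite J" using J A(1) finite_subset by blast
  have single: "event_prob A r (\<lambda>E. e \<in> E) = r e" if "e \<in> J" for e
    using event_prob_subset[OF A, of "{e}"] that J by auto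
  \<comment> \<open>Distinct edges are present independently, so only the diagonal contributes, and
    the variance is at most the mean.\<close>
  have "event_prob A r (\<lambda>E. \<bar>real (card {e \<in> J. e \<in> E}) - (\<Sum>e\<in>J. event_prob A r (\<lambda>E. e \<in> E))\<bar> \<ge> t)
      \<le> (\<Sum>e\<in>J. \<Sum>e'\<in>J. if e = e' then r e else 0) / t\<^sup>2"
  proof (rule count_deviation[OF A(1) fin t])
    fix e e' assume e: "e \<in> J" "e' \<in> J"
    show "event_prob A r (\<lambda>E. e \<in> E \<and> e' \<in> E)
      \<le> event_prob A r (\<lambda>E. e \<in> E) * event_prob A r (\<lambda>E. e' \<in> E) + (if e = e' then r e else 0)"
    proof (cases "e = e'")
      case True
      then show ?thesis using e by (simp add: single)
    next
      case False
      have "event_prob A r (\<lambda>E. {e, e'} \<subseteq> E) = r e * r e'"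
        using event_prob_subset[OF A, of "{e, e'}"] e J False by auto
      then show ?thesis using e False by (simp add: single)
    qed
  qed
  then show ?thesis using fin by (simp add: single)
qed

lemma eventually_rate_bounds:
  assumes "\<alpha> > 0" "\<omega> \<ge> 0" "\<omega> = 0 \<Longrightarrow> \<alpha> < 1"
  shows "eventually (\<lambda>n. 0 \<le> \<alpha> * real n powr (- \<omega>) \<and> \<alpha> * real n powr (- \<omega>) \<le> 1) sequentially"
proof (cases "\<omega> = 0")
  case True
  with assms show ?thesis
    by (intro eventually_mono[OF eventually_gt_at_top[of 0]]) auto
next
  case False
  then have "\<omega> > 0" using assms by simp
  then have "(\<lambda>n. \<alpha> * real n powr (- \<omega>)) \<longlonglongrightarrow> 0" by real_asymp
  then have "eventually (\<lambda>n. \<alpha> * real n powr (- \<omega>) < 1) sequentially"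
    by (rule order_tendstoD) simp
  then show ?thesis by (rule eventually_mono) (use assms in auto)
qed

lemma real_choose_two: "real (n choose 2) = (real n)\<^sup>2 / 2 - real n / 2"
proof (induction n)
  case (Suc n)
  have "Suc n choose 2 = n + (n choose 2)" by (simp add: numeral_2_eq_2)
  then show ?case using Suc by (simp add: power2_eq_square field_simps)
qed simp

text \<open>The means are of order \<open>n powr (2 - \<omega>)\<close> and the variances are at
  most the means, so a deviation by \<epsilon> / 4 times that power becomes unlikely.\<close>

lemma whp_edges:
  assumes ab: "\<alpha> > \<beta>" "\<beta> > 0" and om: "0 \<le> \<omega>" "\<omega> < 1" "\<omega> = 0 \<Longrightarrow> \<alpha> < 1" and eps: "\<epsilon> > 0"
  shows "whp \<alpha> \<beta> \<omega> (\<lambda>n P E. real (card E) < (\<alpha> + \<beta> + \<epsilon>) / 4 * real n powr (2 - \<omega>)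
      \<and> (\<beta> - \<epsilon>) / 4 * real n powr (2 - \<omega>) < real (card {e \<in> E. \<not> same_part P e}))"
proof -
  \<comment> \<open>Chebyshev's bound: a mean of at most
    \<open>(\<alpha> + \<beta>) / 4 * n powr (2 - \<omega>)\<close>, divided by the square of the
    deviation \<open>\<epsilon> / 4 * n powr (2 - \<omega>)\<close>.\<close>
  define f where "f n = 4 * (\<alpha> + \<beta>) / \<epsilon>\<^sup>2 * real n powr (\<omega> - 2)" for n :: nat
  have f0: "f \<longlonglongrightarrow> 0" using om unfolding f_def by real_asymp
  have large: "eventually (\<lambda>n. 0 < n \<and> 0 \<le> \<alpha> * real n powr (- \<omega>) \<and> \<alpha> * real n powr (- \<omega>) \<le> 1) sequentially"
    by (rule eventually_conj[OF eventually_gt_at_top eventually_rate_bounds]) (use ab om in auto)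
  have bounds: "sum (rate \<alpha> \<beta> \<omega> n P) (node_pairs n) \<le> (\<alpha> + \<beta>) / 4 * real n powr (2 - \<omega>)"
    "sum (rate \<alpha> \<beta> \<omega> n P) {e \<in> node_pairs n. \<not> same_part P e} = \<beta> / 4 * real n powr (2 - \<omega>)"
    "\<forall>e\<in>node_pairs n. rate \<alpha> \<beta> \<omega> n P e \<in> {0..1}"
    if n: "0 < n \<and> 0 \<le> \<alpha> * real n powr (- \<omega>) \<and> \<alpha> * real n powr (- \<omega>) \<le> 1" and P: "P \<in> bisections n" for n P
  proof -
    let ?x = "real n powr (- \<omega>)"
    let ?C = "{e \<in> node_pairs n. \<not> same_part P e}" and ?D = "{e \<in> node_pairs n. same_part P e}"
    have pw: "real n powr (2 - \<omega>) = (real n)\<^sup>2 * ?x"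
      using powr_add[of "real n" 2 "- \<omega>"] n by simp
    have cC: "real (card ?C) = (real n)\<^sup>2 / 4"
      using arg_cong[OF card_cross_pairs[OF P], of real] by simp
    have "?C \<union> ?D = node_pairs n" by auto
    then have "card ?C + card ?D = n choose 2"
      by (subst card_Un_disjoint[symmetric]) (auto simp: card_node_pairs)
    moreover have "real (n choose 2) \<le> (real n)\<^sup>2 / 2"
      by (simp add: real_choose_two)
    ultimately have cD: "real (card ?D) \<le> (real n)\<^sup>2 / 4" using cC by linarith
    show C: "sum (rate \<alpha> \<beta> \<omega> n P) ?C = \<beta> / 4 * real n powr (2 - \<omega>)"
      by (simp add: rate_def cC pw)
    have "sum (rate \<alpha> \<beta> \<omega> n P) ?D = real (card ?D) * (\<alpha> * ?x)"
      by (simp add: rate_def)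
    also have "\<dots> \<le> (real n)\<^sup>2 / 4 * (\<alpha> * ?x)"
      using cD n by (intro mult_right_mono) auto
    finally have D: "sum (rate \<alpha> \<beta> \<omega> n P) ?D \<le> \<alpha> / 4 * real n powr (2 - \<omega>)" by (simp add: pw mult_ac)
    have "sum (rate \<alpha> \<beta> \<omega> n P) (node_pairs n) = sum (rate \<alpha> \<beta> \<omega> n P) ?C + sum (rate \<alpha> \<beta> \<omega> n P) ?D"
      by (subst sum.union_disjoint[symmetric]) (auto intro!: sum.cong)
    then show "sum (rate \<alpha> \<beta> \<omega> n P) (node_pairs n) \<le> (\<alpha> + \<beta>) / 4 * real n powr (2 - \<omega>)"
      using C D by (simp add: field_simps)
    have "\<beta> * ?x \<le> \<alpha> * ?x" using ab by (intro mult_right_mono) auto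
    then have "\<beta> * ?x \<le> 1" using n by linarith
    then show "\<forall>e\<in>node_pairs n. rate \<alpha> \<beta> \<omega> n P e \<in> {0..1}"
      using n ab by (auto simp: rate_def)
  qed
  have dev: "event_prob (node_pairs n) (rate \<alpha> \<beta> \<omega> n P)
      (\<lambda>E. \<bar>real (card {e \<in> J. e \<in> E}) - sum (rate \<alpha> \<beta> \<omega> n P) J\<bar> \<ge> \<epsilon> / 4 * real n powr (2 - \<omega>)) \<le> f n"
    if n: "0 < n \<and> 0 \<le> \<alpha> * real n powr (- \<omega>) \<and> \<alpha> * real n powr (- \<omega>) \<le> 1" and P: "P \<in> bisections n"
      and J: "J \<subseteq> node_pairs n" for n P J
  proof -
    let ?t = "\<epsilon> / 4 * real n powr (2 - \<omega>)"
    have t: "0 < ?t" using n eps by simp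
    have "sum (rate \<alpha> \<beta> \<omega> n P) J \<le> sum (rate \<alpha> \<beta> \<omega> n P) (node_pairs n)"
      using bounds(3)[OF n P] J by (intro sum_mono2) auto
    also note bounds(1)[OF n P]
    finally have "sum (rate \<alpha> \<beta> \<omega> n P) J / ?t\<^sup>2 \<le> (\<alpha> + \<beta>) / 4 * real n powr (2 - \<omega>) / ?t\<^sup>2"
      by (intro divide_right_mono) auto
    also have "\<dots> = f n"
    proof -
      have "real n powr (\<omega> - 2) = inverse (real n powr (2 - \<omega>))"
        by (simp flip: powr_minus)
      then show ?thesis using eps n by (simp add: f_def field_simps power2_eq_square)
    qed
    finally show ?thesis
      using edge_count_deviation[OF finite_node_pairs bounds(3)[OF n P] J t] by linarith
  qed
  have "whp \<alpha> \<beta> \<omega> (\<lambda>n P E. real (card E) < (\<alpha> + \<beta> + \<epsilon>) / 4 * real n powr (2 - \<omega>))"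
  proof (rule whpI[OF _ f0], rule eventually_mono[OF large], rule ballI)
    fix n P assume nP: "0 < n \<and> 0 \<le> \<alpha> * real n powr (- \<omega>) \<and> \<alpha> * real n powr (- \<omega>) \<le> 1" "P \<in> bisections n"
    have "event_prob (node_pairs n) (rate \<alpha> \<beta> \<omega> n P)
        (\<lambda>E. \<not> real (card E) < (\<alpha> + \<beta> + \<epsilon>) / 4 * real n powr (2 - \<omega>))
      \<le> event_prob (node_pairs n) (rate \<alpha> \<beta> \<omega> n P)
      (\<lambda>E. \<bar>real (card {e \<in> node_pairs n. e \<in> E}) - sum (rate \<alpha> \<beta> \<omega> n P) (node_pairs n)\<bar> \<ge> \<epsilon> / 4 * real n powr (2 - \<omega>))"
    proof (rule event_prob_mono[OF finite_node_pairs])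
      fix E assume E: "E \<subseteq> node_pairs n" "\<not> real (card E) < (\<alpha> + \<beta> + \<epsilon>) / 4 * real n powr (2 - \<omega>)"
      have "{e \<in> node_pairs n. e \<in> E} = E" using E(1) by auto
      then show "\<bar>real (card {e \<in> node_pairs n. e \<in> E}) - sum (rate \<alpha> \<beta> \<omega> n P) (node_pairs n)\<bar>
          \<ge> \<epsilon> / 4 * real n powr (2 - \<omega>)"
        using E(2) bounds(1)[OF nP] by (intro order_trans[OF _ abs_ge_self]) (simp add: field_simps)
    qed
    also have "\<dots> \<le> f n" by (rule dev[OF nP order_refl])
    finally show "event_prob (node_pairs n) (rate \<alpha> \<beta> \<omega> n P)
        (\<lambda>E. \<not> real (card E) < (\<alpha> + \<beta> + \<epsilon>) / 4 * real n powr (2 - \<omega>)) \<le> f n" .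
  qed
  moreover have "whp \<alpha> \<beta> \<omega> (\<lambda>n P E. (\<beta> - \<epsilon>) / 4 * real n powr (2 - \<omega>) < real (card {e \<in> E. \<not> same_part P e}))"
  proof (rule whpI[OF _ f0], rule eventually_mono[OF large], rule ballI)
    fix n P assume nP: "0 < n \<and> 0 \<le> \<alpha> * real n powr (- \<omega>) \<and> \<alpha> * real n powr (- \<omega>) \<le> 1" "P \<in> bisections n"
    let ?C = "{e \<in> node_pairs n. \<not> same_part P e}"
    have "event_prob (node_pairs n) (rate \<alpha> \<beta> \<omega> n P)
        (\<lambda>E. \<not> (\<beta> - \<epsilon>) / 4 * real n powr (2 - \<omega>) < real (card {e \<in> E. \<not> same_part P e}))
      \<le> event_prob (node_pairs n) (rate \<alpha> \<beta> \<omega> n P)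
      (\<lambda>E. \<bar>real (card {e \<in> ?C. e \<in> E}) - sum (rate \<alpha> \<beta> \<omega> n P) ?C\<bar> \<ge> \<epsilon> / 4 * real n powr (2 - \<omega>))"
    proof (rule event_prob_mono[OF finite_node_pairs])
      fix E assume E: "E \<subseteq> node_pairs n" "\<not> (\<beta> - \<epsilon>) / 4 * real n powr (2 - \<omega>) < real (card {e \<in> E. \<not> same_part P e})"
      have "{e \<in> ?C. e \<in> E} = {e \<in> E. \<not> same_part P e}" using E(1) by auto
      then show "\<bar>real (card {e \<in> ?C. e \<in> E}) - sum (rate \<alpha> \<beta> \<omega> n P) ?C\<bar> \<ge> \<epsilon> / 4 * real n powr (2 - \<omega>)"
        using E(2) bounds(2)[OF nP] by (intro order_trans[OF _ abs_ge_minus_self]) (simp add: field_simps)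
    qed
    also have "\<dots> \<le> f n" by (rule dev[OF nP]) auto
    finally show "event_prob (node_pairs n) (rate \<alpha> \<beta> \<omega> n P)
        (\<lambda>E. \<not> (\<beta> - \<epsilon>) / 4 * real n powr (2 - \<omega>) < real (card {e \<in> E. \<not> same_part P e})) \<le> f n" .
  qed
  ultimately show ?thesis by (rule whp_conj)
qed

section \<open>Limits of the avoidance probability and of the covariance bound\<close>

lemma tendsto_one_minus_power:
  fixes x :: "nat \<Rightarrow> real" and N :: "nat \<Rightarrow> nat"
  assumes x: "x \<longlonglongrightarrow> 0" "eventually (\<lambda>n. 0 < x n) sequentially"
    and L: "(\<lambda>n. real (N n) * x n) \<longlonglongrightarrow> L"
  shows "(\<lambda>n. (1 - x n) ^ N n) \<longlonglongrightarrow> exp (- L)"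
proof -
  \<comment> \<open>The logarithm of the power is \<open>N n * x n\<close> times
    \<open>ln (1 - x n) / x n\<close>, and the latter quotient tends to \<open>-1\<close>.\<close>
  have "((\<lambda>x::real. ln (1 - x) / x) \<longlongrightarrow> -1) (at_right 0)" by real_asymp
  moreover have "filterlim x (at_right 0) sequentially"
    using x by (intro tendsto_imp_filterlim_at_right) auto
  ultimately have "(\<lambda>n. ln (1 - x n) / x n) \<longlonglongrightarrow> -1"
    by (rule filterlim_compose)
  then have "(\<lambda>n. real (N n) * x n * (ln (1 - x n) / x n)) \<longlonglongrightarrow> L * (-1)"
    by (intro tendsto_mult L)
  then have *: "(\<lambda>n. exp (real (N n) * x n * (ln (1 - x n) / x n))) \<longlonglongrightarrow> exp (- L)"
    by (intro tendsto_exp) simp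
  have "eventually (\<lambda>n. x n < 1) sequentially"
    using x(1) by (rule order_tendstoD) simp
  then have "eventually (\<lambda>n. exp (real (N n) * x n * (ln (1 - x n) / x n)) = (1 - x n) ^ N n) sequentially"
    using x(2) by eventually_elim (simp add: exp_of_nat_mult)
  with * show ?thesis by (simp cong: tendsto_cong)
qed

text \<open>For \<open>p = \<alpha> * n powr (- \<omega>)\<close>, the product
  \<open>n ^ (m - 1) * p ^ m\<close> is
  \<open>\<alpha> ^ m * n powr (m * (1 - \<omega>) - 1)\<close>. It vanishes in the limit except for
  \<open>m = k\<close> with \<open>k * (1 - \<omega>) = 1\<close>, so only that factor can have a
  limit other than one.\<close>

lemma no_path_limit:
  fixes \<alpha> \<omega> :: real
  assumes a: "\<alpha> > 0" and om: "0 < \<omega>" "\<omega> < 1" and k: "real k * (1 - \<omega>) \<le> 1"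
  shows "(\<lambda>n. \<Prod>m=1..k. (1 - (\<alpha> * real n powr (- \<omega>)) ^ m) ^ (n ^ (m - 1)))
    \<longlonglongrightarrow> (if real k * (1 - \<omega>) = 1 then exp (- (\<alpha> ^ k)) else 1)"
proof -
  let ?p = "\<lambda>n. \<alpha> * real n powr (- \<omega>)"
  have "(\<lambda>n. \<Prod>m=1..k. (1 - ?p n ^ m) ^ (n ^ (m - 1)))
    \<longlonglongrightarrow> (\<Prod>m=1..k. if m = k then (if real k * (1 - \<omega>) = 1 then exp (- (\<alpha> ^ k)) else 1) else 1)"
  proof (rule tendsto_prod)
    fix m assume m: "m \<in> {1..k}"
    have p0: "?p \<longlonglongrightarrow> 0" using om by real_asymp
    have "(0::real) ^ m = 0" using m by simp
    with tendsto_power[OF p0, of m] have x: "(\<lambda>n. ?p n ^ m) \<longlonglongrightarrow> 0" by (simp only:)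
    have pos: "eventually (\<lambda>n. 0 < ?p n ^ m) sequentially"
      using eventually_gt_at_top[of 0] by eventually_elim (use a in auto)
    define s where "s = real m * (1 - \<omega>) - 1"
    have "m < k \<Longrightarrow> real m * (1 - \<omega>) < real k * (1 - \<omega>)" using om by (intro mult_strict_right_mono) auto
    then have s: "s = 0 \<longleftrightarrow> m = k \<and> real k * (1 - \<omega>) = 1" "s \<le> 0"
      using m k by (cases "m = k"; auto simp: s_def)+
    have "eventually (\<lambda>n. real (n ^ (m - 1)) * ?p n ^ m = \<alpha> ^ m * real n powr s) sequentially"
      using eventually_gt_at_top[of 0]
    proof eventually_elim
      case (elim n)
      have "real n ^ (m - 1) = real n powr real (m - 1)"
        using elim by (simp add: powr_realpow)
      moreover have "(real n powr (- \<omega>)) ^ m = real n powr (real m * - \<omega>)"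
        using elim by (intro powr_power) simp
      ultimately have "real (n ^ (m - 1)) * ?p n ^ m = \<alpha> ^ m * real n powr (real (m - 1) + real m * - \<omega>)"
        unfolding power_mult_distrib powr_add of_nat_power by simp
      also have "real (m - 1) + real m * - \<omega> = s" using m by (simp add: s_def of_nat_diff algebra_simps)
      finally show ?case .
    qed
    moreover have "(\<lambda>n. \<alpha> ^ m * real n powr s) \<longlonglongrightarrow> (if s = 0 then \<alpha> ^ m else 0)"
    proof (cases "s = 0")
      case True
      have "eventually (\<lambda>n. \<alpha> ^ m * real n powr s = \<alpha> ^ m) sequentially"
        using eventually_gt_at_top[of 0] by eventually_elim (simp add: True)
      then show ?thesis using True by (simp add: tendsto_eventually)
    next
      case False
      then have "s < 0" using s(2) by linarith
      then have "(\<lambda>n. \<alpha> ^ m * real n powr s) \<longlonglongrightarrow> 0" by real_asymp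
      then show ?thesis using False by simp
    qed
    ultimately have "(\<lambda>n. real (n ^ (m - 1)) * ?p n ^ m) \<longlonglongrightarrow> (if s = 0 then \<alpha> ^ m else 0)"
      by (rule tendsto_cong[THEN iffD2])
    from tendsto_one_minus_power[OF x pos this] show "(\<lambda>n. (1 - ?p n ^ m) ^ (n ^ (m - 1)))
        \<longlonglongrightarrow> (if m = k then (if real k * (1 - \<omega>) = 1 then exp (- (\<alpha> ^ k)) else 1) else 1)"
      using s(1) by (auto split: if_splits)
  qed
  also have "(\<Prod>m=1..k. if m = k then (if real k * (1 - \<omega>) = 1 then exp (- (\<alpha> ^ k)) else 1) else 1)
      = (if real k * (1 - \<omega>) = 1 then exp (- (\<alpha> ^ k)) else 1)"
    using k by (cases "k = 0") (auto simp: prod.delta)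
  finally show ?thesis .
qed

text \<open>The term with \<open>c\<close> vertices has the order of \<open>n\<close> to the
  exponent \<open>(c - 1) * (1 - \<omega>) - 3\<close>, and \<open>c - 1 \<le> 2 * k\<close> makes
  this exponent at most \<open>-1\<close>.\<close>

lemma overlap_limit:
  fixes \<alpha> \<omega> :: real
  assumes a: "\<alpha> > 0" and om: "0 < \<omega>" "\<omega> < 1" and k: "real k * (1 - \<omega>) \<le> 1" and t: "t > 0"
  shows "(\<lambda>n. overlap_bound n k (\<alpha> * real n powr (- \<omega>)) / (t * (real n)\<^sup>2)\<^sup>2) \<longlonglongrightarrow> 0"
proof -
  let ?p = "\<lambda>n. \<alpha> * real n powr (- \<omega>)"
  let ?B = "real (\<Sum>i\<le>Suc k. (2 * k + 1) ^ i) ^ 2 / t\<^sup>2"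
  have "(\<lambda>n. ?B * (\<Sum>c=1..2 * k + 1. real n ^ c * ?p n ^ (c - 1) / real n ^ 4)) \<longlonglongrightarrow> ?B * (\<Sum>c=1..2*k+1. 0)"
  proof (intro tendsto_mult tendsto_const tendsto_sum)
    fix c assume c: "c \<in> {1..2 * k + 1}"
    define s where "s = real c - \<omega> * real (c - 1) - 4"
    have "real (c - 1) * (1 - \<omega>) \<le> real (2 * k) * (1 - \<omega>)"
      using c om by (intro mult_right_mono) auto
    also have "\<dots> \<le> 2" using k by simp
    finally have "s < 0" using c by (simp add: s_def of_nat_diff algebra_simps)
    have "eventually (\<lambda>n. real n ^ c * ?p n ^ (c - 1) / real n ^ 4 = \<alpha> ^ (c - 1) * real n powr s) sequentially"
      using eventually_gt_at_top[of 0]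
    proof eventually_elim
      case (elim n)
      have "real n ^ c = real n powr real c" "real n ^ 4 = real n powr 4"
        using elim by (simp_all add: powr_realpow)
      moreover have "(real n powr (- \<omega>)) ^ (c - 1) = real n powr (real (c - 1) * - \<omega>)"
        using elim by (intro powr_power) simp
      moreover have "s = real c + real (c - 1) * - \<omega> - 4" by (simp add: s_def)
      then have "real n powr s = real n powr real c * real n powr (real (c - 1) * - \<omega>) / real n powr 4"
        by (simp only: powr_add powr_diff)
      ultimately show ?case unfolding power_mult_distrib by (simp only: mult.left_commute times_divide_eq_right)
    qed
    moreover have "(\<lambda>n. \<alpha> ^ (c - 1) * real n powr s) \<longlonglongrightarrow> 0" using \<open>s < 0\<close> by real_asymp
    ultimately show "(\<lambda>n. real n ^ c * ?p n ^ (c - 1) / real n ^ 4) \<longlonglongrightarrow> 0"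
      by (rule tendsto_cong[THEN iffD2])
  qed
  moreover have "overlap_bound n k (?p n) / (t * (real n)\<^sup>2)\<^sup>2
      = ?B * (\<Sum>c=1..2 * k + 1. real n ^ c * ?p n ^ (c - 1) / real n ^ 4)" for n
    by (simp add: overlap_bound_def power_mult_distrib sum_divide_distrib[symmetric] del: sum.cl_ivl_Suc)
  ultimately show ?thesis by simp
qed

text \<open>There are about \<open>n^2 / 2\<close> pairs, so the conditional expression is an
  asymptotic lower bound for the fraction of pairs at distance more than \<open>k\<close>.\<close>

lemma whp_linked:
  assumes ab: "\<alpha> > \<beta>" "\<beta> > 0" and om: "0 < \<omega>" "\<omega> < 1" and k: "real k * (1 - \<omega>) \<le> 1" and eps: "\<epsilon> > 0"
  shows "whp \<alpha> \<beta> \<omega> (\<lambda>n P E. real (card {e \<in> node_pairs n. linked n k E e})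
    \<le> ((1 - (if real k * (1 - \<omega>) = 1 then exp (- (\<alpha> ^ k)) else 1)) / 2 + \<epsilon>) * (real n)\<^sup>2)"
proof -
  let ?p = "\<lambda>n. \<alpha> * real n powr (- \<omega>)"
  define c where "c = (if real k * (1 - \<omega>) = 1 then exp (- (\<alpha> ^ k)) else 1)"
  define R where "R n = (\<Prod>m=1..k. (1 - ?p n ^ m) ^ (n ^ (m - 1)))" for n
  have a: "\<alpha> > 0" using ab by simp
  have "R \<longlonglongrightarrow> c" unfolding R_def c_def by (rule no_path_limit[OF a om k])
  then have "eventually (\<lambda>n. c - \<epsilon> < R n) sequentially"
    using eps by (intro order_tendstoD) auto
  moreover have "eventually (\<lambda>n. 0 \<le> ?p n \<and> ?p n \<le> 1) sequentially"
    using a om by (intro eventually_rate_bounds) auto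
  ultimately have "eventually (\<lambda>n. \<forall>P\<in>bisections n. event_prob (node_pairs n) (rate \<alpha> \<beta> \<omega> n P)
      (\<lambda>E. \<not> real (card {e \<in> node_pairs n. linked n k E e}) \<le> ((1 - c) / 2 + \<epsilon>) * (real n)\<^sup>2)
      \<le> overlap_bound n k (?p n) / (\<epsilon> / 2 * (real n)\<^sup>2)\<^sup>2) sequentially"
    using eventually_gt_at_top[of 0]
  proof eventually_elim
    case (elim n)
    \<comment> \<open>Half of \<epsilon> pays for the gap between \<open>R n\<close> and its limit,
      the other half is the allowed deviation.\<close>
    let ?t = "\<epsilon> / 2 * (real n)\<^sup>2"
    show ?case
    proof
      fix P assume "P \<in> bisections n"
      have "\<beta> * real n powr (- \<omega>) \<le> ?p n" using ab by (intro mult_right_mono) auto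
      then have r: "\<forall>e\<in>node_pairs n. rate \<alpha> \<beta> \<omega> n P e \<in> {0..?p n}"
        using ab elim by (auto simp: rate_def)
      have "R n \<le> 1"
        unfolding R_def using elim by (intro prod_le_1 conjI power_le_one zero_le_power) (auto simp: power_le_one)
      have "real (n choose 2) * (1 - R n) \<le> (real n)\<^sup>2 / 2 * (1 - R n)"
        using \<open>R n \<le> 1\<close> by (intro mult_right_mono) (auto simp: real_choose_two)
      also have "\<dots> \<le> (real n)\<^sup>2 / 2 * (1 - c + \<epsilon>)"
        using elim by (intro mult_left_mono) auto
      finally have bd: "real (n choose 2) * (1 - R n) + ?t \<le> ((1 - c) / 2 + \<epsilon>) * (real n)\<^sup>2"
        by (simp add: field_simps)
      have "event_prob (node_pairs n) (rate \<alpha> \<beta> \<omega> n P)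
          (\<lambda>E. \<not> real (card {e \<in> node_pairs n. linked n k E e}) \<le> ((1 - c) / 2 + \<epsilon>) * (real n)\<^sup>2)
        \<le> event_prob (node_pairs n) (rate \<alpha> \<beta> \<omega> n P)
          (\<lambda>E. real (card {e \<in> node_pairs n. linked n k E e}) \<ge> real (n choose 2) * (1 - R n) + ?t)"
        using bd by (intro event_prob_mono) auto
      also have "\<dots> \<le> overlap_bound n k (?p n) / ?t\<^sup>2"
        unfolding R_def by (rule linked_tail[OF r]) (use elim eps in auto)
      finally show "event_prob (node_pairs n) (rate \<alpha> \<beta> \<omega> n P)
          (\<lambda>E. \<not> real (card {e \<in> node_pairs n. linked n k E e}) \<le> ((1 - c) / 2 + \<epsilon>) * (real n)\<^sup>2)
        \<le> overlap_bound n k (?p n) / ?t\<^sup>2" .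
    qed
  qed
  then show ?thesis
    unfolding c_def by (rule whpI) (use overlap_limit[OF a om k, of "\<epsilon> / 2"] eps in simp)
qed

text \<open>Here \<open>c\<close> is an asymptotic lower bound for the fraction of pairs at distance
  more than \<open>d\<close>. The sum of the truncated distances is then at least about
  \<open>l * n^2\<close> with \<open>l = (d + (T - d) * c) / 2\<close>, and the two strict
  inequalities place \<open>l\<close> above the two thresholds required by
  \<open>not_lp_recovers\<close>.\<close>

lemma whp_not_recovers:
  assumes ab: "\<alpha> > \<beta>" "\<beta> > 0" and om: "0 \<le> \<omega>" "\<omega> < 1" "\<omega> = 0 \<Longrightarrow> \<alpha> < 1"
    and d: "1 \<le> d" and T: "real d \<le> T" "T \<le> real d + 1"
    and near: "\<And>\<epsilon>. \<epsilon> > 0 \<Longrightarrow> whp \<alpha> \<beta> \<omega> (\<lambda>n P E. real (card {e \<in> node_pairs n. linked n (d - 1) E e}) \<le> \<epsilon> * (real n)\<^sup>2)"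
    and far: "\<And>\<epsilon>. \<epsilon> > 0 \<Longrightarrow> whp \<alpha> \<beta> \<omega> (\<lambda>n P E. real (card {e \<in> node_pairs n. linked n d E e}) \<le> ((1 - c) / 2 + \<epsilon>) * (real n)\<^sup>2)"
    and perimeter: "3 * T / 4 < real d + (T - real d) * c"
    and cost: "(\<alpha> + \<beta>) / (2 * \<beta>) < real d + (T - real d) * c"
  shows "whp \<alpha> \<beta> \<omega> (\<lambda>n P E. \<not> lp_recovers n P E)"
proof -
  define l where "l = (real d + (T - real d) * c) / 2"
  have T0: "0 < T" using T d by linarith
  have "max (3 * T / 8) ((\<alpha> + \<beta>) / (4 * \<beta>)) < l"
    using perimeter cost by (simp add: l_def)
  \<comment> \<open>The lower bound used for the sum is \<open>\<kappa> * n^2\<close>; the gap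
    \<open>l - \<kappa>\<close> is left for the error terms.\<close>
  then obtain \<kappa> where \<kappa>: "3 * T / 8 < \<kappa>" "(\<alpha> + \<beta>) / (4 * \<beta>) < \<kappa>" "\<kappa> < l"
    using dense by (metis max_less_iff_conj)
  have \<kappa>0: "0 < \<kappa>" using \<kappa>(1) T0 by linarith
  have slack: "0 < 4 * \<kappa> * \<beta> - \<alpha> - \<beta>" using \<kappa>(2) ab by (simp add: field_simps)
  \<comment> \<open>The solution of \<open>\<alpha> + \<beta> + \<eta> = 4 * \<kappa> * (\<beta> -
    \<eta>)\<close>: with this much fluctuation in both edge counts the cost comparison still
    closes.\<close>
  define \<eta> where "\<eta> = (4 * \<kappa> * \<beta> - \<alpha> - \<beta>) / (1 + 4 * \<kappa>)"
  have "\<eta> * (1 + 4 * \<kappa>) = 4 * \<kappa> * \<beta> - \<alpha> - \<beta>" using \<kappa>0 by (simp add: \<eta>_def)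
  then have \<eta>: "\<eta> > 0" "\<alpha> + \<beta> + \<eta> = 4 * \<kappa> * (\<beta> - \<eta>)"
    using slack \<kappa>0 by (simp add: \<eta>_def, simp add: algebra_simps)
  \<comment> \<open>The linked pairs cost at most \<open>T * \<epsilon>\<close>, half of the gap.
    The other half absorbs the linear term of \<open>n choose 2\<close> for large
    \<open>n\<close>.\<close>
  define \<epsilon> where "\<epsilon> = (l - \<kappa>) / (2 * T)"
  have \<epsilon>: "\<epsilon> > 0" "T * \<epsilon> = (l - \<kappa>) / 2" using \<kappa>(3) T0 by (simp_all add: \<epsilon>_def)
  have "whp \<alpha> \<beta> \<omega> (\<lambda>n P E. (real (card {e \<in> node_pairs n. linked n (d - 1) E e}) \<le> \<epsilon> * (real n)\<^sup>2
      \<and> real (card {e \<in> node_pairs n. linked n d E e}) \<le> ((1 - c) / 2 + \<epsilon>) * (real n)\<^sup>2)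
      \<and> real (card E) < (\<alpha> + \<beta> + \<eta>) / 4 * real n powr (2 - \<omega>)
      \<and> (\<beta> - \<eta>) / 4 * real n powr (2 - \<omega>) < real (card {e \<in> E. \<not> same_part P e}))"
    using \<epsilon> \<eta> by (intro whp_conj[OF whp_conj] near far whp_edges ab om)
  then show ?thesis
  proof (rule whp_mono)
    have "eventually (\<lambda>n. T / (l - \<kappa>) < real n) sequentially"
      using filterlim_real_sequentially eventually_gt_at_top filterlim_iff by blast
    then show "\<forall>\<^sub>F n in sequentially. \<forall>P\<in>bisections n. \<forall>E\<subseteq>node_pairs n.
      (real (card {e \<in> node_pairs n. linked n (d - 1) E e}) \<le> \<epsilon> * (real n)\<^sup>2
      \<and> real (card {e \<in> node_pairs n. linked n d E e}) \<le> ((1 - c) / 2 + \<epsilon>) * (real n)\<^sup>2)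
      \<and> real (card E) < (\<alpha> + \<beta> + \<eta>) / 4 * real n powr (2 - \<omega>)
      \<and> (\<beta> - \<eta>) / 4 * real n powr (2 - \<omega>) < real (card {e \<in> E. \<not> same_part P e})
      \<longrightarrow> \<not> lp_recovers n P E"
      using eventually_gt_at_top[of 0]
    proof eventually_elim
      case (elim n)
      show ?case
      proof (intro ballI allI impI)
        fix P E
        assume E: "E \<subseteq> node_pairs n"
          and bounds: "(real (card {e \<in> node_pairs n. linked n (d - 1) E e}) \<le> \<epsilon> * (real n)\<^sup>2
            \<and> real (card {e \<in> node_pairs n. linked n d E e}) \<le> ((1 - c) / 2 + \<epsilon>) * (real n)\<^sup>2)
            \<and> real (card E) < (\<alpha> + \<beta> + \<eta>) / 4 * real n powr (2 - \<omega>)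
            \<and> (\<beta> - \<eta>) / 4 * real n powr (2 - \<omega>) < real (card {e \<in> E. \<not> same_part P e})"
        let ?K = "\<Sum>e\<in>node_pairs n. tdist d T E (Min e) (Max e)"
        let ?x = "card {e \<in> node_pairs n. linked n (d - 1) E e}" and ?y = "card {e \<in> node_pairs n. linked n d E e}"
        let ?X = "card {e \<in> E. \<not> same_part P e}"
        have "real d * (real (n choose 2) - \<epsilon> * (real n)\<^sup>2)
            + (T - real d) * (real (n choose 2) - ((1 - c) / 2 + \<epsilon>) * (real n)\<^sup>2)
          \<le> real d * (real (n choose 2) - real ?x) + (T - real d) * (real (n choose 2) - real ?y)"
          using bounds T by (intro add_mono mult_left_mono) auto
        also have "\<dots> \<le> ?K" by (rule sum_tdist_ge[OF E T(1) d])
        also have "real d * (real (n choose 2) - \<epsilon> * (real n)\<^sup>2)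
            + (T - real d) * (real (n choose 2) - ((1 - c) / 2 + \<epsilon>) * (real n)\<^sup>2)
          = (l - T * \<epsilon>) * (real n)\<^sup>2 - T / 2 * real n"
          by (simp add: real_choose_two l_def field_simps)
        finally have "(l - T * \<epsilon>) * (real n)\<^sup>2 - T / 2 * real n \<le> ?K" .
        moreover have "T / 2 * real n \<le> (l - \<kappa>) / 2 * (real n)\<^sup>2"
        proof -
          have "T \<le> (l - \<kappa>) * real n" using elim(1) \<kappa>(3) by (simp add: field_simps)
          then have "T / 2 * real n \<le> (l - \<kappa>) * real n / 2 * real n" by (intro mult_right_mono) auto
          then show ?thesis by (simp add: power2_eq_square)
        qed
        ultimately have K: "\<kappa> * (real n)\<^sup>2 \<le> ?K" unfolding \<epsilon>(2) by (simp add: field_simps)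
        have "3 * T / 8 * (real n)\<^sup>2 \<le> \<kappa> * (real n)\<^sup>2" using \<kappa>(1) by (intro mult_right_mono) auto
        with K have per: "3 * T / 8 * (real n)\<^sup>2 \<le> ?K" by linarith
        have "real (card E) * (real n)\<^sup>2 < (\<alpha> + \<beta> + \<eta>) / 4 * real n powr (2 - \<omega>) * (real n)\<^sup>2"
          using bounds elim(2) by (intro mult_strict_right_mono) auto
        also have "\<dots> = 4 * (\<kappa> * (real n)\<^sup>2) * ((\<beta> - \<eta>) / 4 * real n powr (2 - \<omega>))"
          unfolding \<eta>(2) by simp
        also have "\<dots> \<le> 4 * (\<kappa> * (real n)\<^sup>2) * real ?X"
          using bounds \<kappa>0 by (intro mult_left_mono) auto
        also have "\<dots> \<le> 4 * ?K * real ?X"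
          using K by (intro mult_right_mono) auto
        finally have cheap: "real (card E) * (real n)\<^sup>2 < 4 * ?K * real ?X" .
        show "\<not> lp_recovers n P E"
          by (rule not_lp_recovers[OF E T d elim(2) refl per cheap])
      qed
    qed
  qed
qed

section \<open>The four regimes\<close>

text \<open>Since \<open>d * (1 - \<omega>) \<le> 1\<close>, the value \<open>d - 1\<close> lies
  strictly below the threshold, so a vanishing fraction of pairs is linked within
  \<open>d - 1\<close>. At \<open>d\<close> itself equality is possible, which is when the
  exponential enters.\<close>

lemma whp_not_recovers_sparse:
  assumes ab: "\<alpha> > \<beta>" "\<beta> > 0" and om: "0 < \<omega>" "\<omega> < 1"
    and d: "1 \<le> d" "real d * (1 - \<omega>) \<le> 1" and T: "real d \<le> T" "T \<le> real d + 1"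
    and c: "c = (if real d * (1 - \<omega>) = 1 then exp (- (\<alpha> ^ d)) else 1)"
    and perimeter: "3 * T / 4 < real d + (T - real d) * c"
    and cost: "(\<alpha> + \<beta>) / (2 * \<beta>) < real d + (T - real d) * c"
  shows "whp \<alpha> \<beta> \<omega> (\<lambda>n P E. \<not> lp_recovers n P E)"
proof (rule whp_not_recovers[OF ab _ om(2) _ d(1) T _ _ perimeter cost])
  fix \<epsilon> :: real assume eps: "\<epsilon> > 0"
  have "real (d - 1) * (1 - \<omega>) < real d * (1 - \<omega>)"
    using d om by (intro mult_strict_right_mono) auto
  then have "real (d - 1) * (1 - \<omega>) < 1" using d by linarith
  then show "whp \<alpha> \<beta> \<omega> (\<lambda>n P E. real (card {e \<in> node_pairs n. linked n (d - 1) E e}) \<le> \<epsilon> * (real n)\<^sup>2)"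
    using whp_linked[OF ab om _ eps, of "d - 1"] by simp
  show "whp \<alpha> \<beta> \<omega> (\<lambda>n P E. real (card {e \<in> node_pairs n. linked n d E e}) \<le> ((1 - c) / 2 + \<epsilon>) * (real n)\<^sup>2)"
    unfolding c by (rule whp_linked[OF ab om d(2) eps])
qed (use om in auto)

section \<open>The dense regime\<close>

lemma not_linked_0: "\<not> linked n 0 E e"
  by (simp add: linked_def paths_def all_paths_def)

lemma linked_1_in_edges:
  assumes "linked n 1 E e" "e \<in> node_pairs n"
  shows "e \<in> E"
proof -
  from assms(1) obtain vs where vs: "vs \<in> paths n 1 e" "path_edges vs \<subseteq> E" by (auto simp: linked_def)
  then have "length vs = 2" by (auto simp: paths_def all_paths_def)
  then obtain u v where "vs = [u, v]" by (auto simp: length_Suc_conv numeral_2_eq_2)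
  with vs have "{Min e, Max e} \<in> E" by (auto simp: paths_def)
  moreover have "{Min e, Max e} = e" using assms(2) by (rule node_pairsE) (simp add: Min_Max_doubleton)
  ultimately show ?thesis by simp
qed

text \<open>With \<open>d = 1\<close>, no pair is linked within distance \<open>0\<close>, and the
  pairs linked within distance \<open>1\<close> are edges, about the fraction
  \<open>(\<alpha> + \<beta>) / 2\<close> of all pairs. This explains the coefficient of
  \<open>T - 1\<close>.\<close>

lemma whp_not_recovers_dense:
  assumes ab: "\<alpha> > \<beta>" "\<beta> > 0" "\<alpha> < 1"
    and T: "1 \<le> T" "T \<le> 2"
    and perimeter: "3 * T / 4 < 1 + (T - 1) * (1 - (\<alpha> + \<beta>) / 2)"
    and cost: "(\<alpha> + \<beta>) / (2 * \<beta>) < 1 + (T - 1) * (1 - (\<alpha> + \<beta>) / 2)"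
  shows "whp \<alpha> \<beta> 0 (\<lambda>n P E. \<not> lp_recovers n P E)"
proof (rule whp_not_recovers[where d = 1 and T = T and c = "1 - (\<alpha> + \<beta>) / 2"])
  fix \<epsilon> :: real assume eps: "\<epsilon> > 0"
  have edges: "whp \<alpha> \<beta> 0 (\<lambda>n P E. real (card E) < (\<alpha> + \<beta> + 4 * \<epsilon>) / 4 * real n powr (2 - 0)
      \<and> (\<beta> - 4 * \<epsilon>) / 4 * real n powr (2 - 0) < real (card {e \<in> E. \<not> same_part P e}))"
    using ab eps by (intro whp_edges) auto
  show "whp \<alpha> \<beta> 0 (\<lambda>n P E. real (card {e \<in> node_pairs n. linked n (1 - 1) E e}) \<le> \<epsilon> * (real n)\<^sup>2)"
    using eps by (intro whp_mono[OF edges]) (simp add: not_linked_0)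
  show "whp \<alpha> \<beta> 0 (\<lambda>n P E. real (card {e \<in> node_pairs n. linked n 1 E e})
      \<le> ((1 - (1 - (\<alpha> + \<beta>) / 2)) / 2 + \<epsilon>) * (real n)\<^sup>2)"
  proof (rule whp_mono[OF edges], rule eventually_mono[OF eventually_gt_at_top[of 0]], intro ballI allI impI)
    fix n :: nat and P E
    assume n: "0 < n" and E: "E \<subseteq> node_pairs n"
      and bd: "real (card E) < (\<alpha> + \<beta> + 4 * \<epsilon>) / 4 * real n powr (2 - 0)
        \<and> (\<beta> - 4 * \<epsilon>) / 4 * real n powr (2 - 0) < real (card {e \<in> E. \<not> same_part P e})"
    have "finite E" using finite_subset[OF E] by simp
    then have "card {e \<in> node_pairs n. linked n 1 E e} \<le> card E"
      by (intro card_mono) (auto intro: linked_1_in_edges simp del: One_nat_def)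
    then have "real (card {e \<in> node_pairs n. linked n 1 E e}) \<le> real (card E)" by simp
    also have "\<dots> \<le> (\<alpha> + \<beta> + 4 * \<epsilon>) / 4 * (real n)\<^sup>2" using bd n by simp
    also have "\<dots> = ((1 - (1 - (\<alpha> + \<beta>) / 2)) / 2 + \<epsilon>) * (real n)\<^sup>2" by (simp add: field_simps)
    finally show "real (card {e \<in> node_pairs n. linked n 1 E e})
      \<le> ((1 - (1 - (\<alpha> + \<beta>) / 2)) / 2 + \<epsilon>) * (real n)\<^sup>2" .
  qed
qed (use assms in auto)

text \<open>With \<open>s\<close> the average edge density, the square root condition gives the cost
  condition at \<open>T = 2\<close>, and \<open>2 * \<alpha> - 1 < \<beta>\<close> leaves room for
  some \<open>T\<close> when the perimeter condition forces \<open>T\<close> below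
  \<open>2\<close>.\<close>

lemma case_dense:
  fixes \<alpha> \<beta> :: real
  assumes ab: "\<alpha> > \<beta>" "\<beta> > 0" "\<alpha> < 1"
    and root: "\<beta> > (3 - \<alpha> - sqrt ((3 - \<alpha>)\<^sup>2 - 4 * \<alpha>)) / 2" and lin: "\<beta> > 2 * \<alpha> - 1"
  shows "whp \<alpha> \<beta> 0 (\<lambda>n P E. \<not> lp_recovers n P E)"
proof -
  define s where "s = (\<alpha> + \<beta>) / 2"
  have s: "0 < s" "s < 1" using ab by (auto simp: s_def)
  have cost_eq: "(\<alpha> + \<beta>) / (2 * \<beta>) = s / \<beta>" by (simp add: s_def)
  have "(3 - \<alpha>)\<^sup>2 - 4 * \<alpha> = (1 - \<alpha>) * (9 - \<alpha>)" by (simp add: power2_eq_square algebra_simps)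
  also have "0 \<le> \<dots>" using ab by simp
  finally have D: "0 \<le> (3 - \<alpha>)\<^sup>2 - 4 * \<alpha>" .
  have "3 - \<alpha> - 2 * \<beta> < sqrt ((3 - \<alpha>)\<^sup>2 - 4 * \<alpha>)" using root by simp
  moreover have "0 \<le> 3 - \<alpha> - 2 * \<beta>" using ab by simp
  ultimately have "(3 - \<alpha> - 2 * \<beta>)\<^sup>2 < (sqrt ((3 - \<alpha>)\<^sup>2 - 4 * \<alpha>))\<^sup>2"
    by (intro power_strict_mono) auto
  then have "(3 - \<alpha> - 2 * \<beta>)\<^sup>2 < (3 - \<alpha>)\<^sup>2 - 4 * \<alpha>" using D by simp
  then have quad: "s < \<beta> * (2 - s)" by (simp add: s_def power2_eq_square field_simps)
  have main: ?thesis if "1 \<le> T" "T \<le> 2" "3 * T / 4 < 1 + (T - 1) * (1 - s)" "s / \<beta> < 1 + (T - 1) * (1 - s)" for T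
    by (rule whp_not_recovers_dense[OF ab that(1,2)]) (use that(3,4) in \<open>simp_all only: cost_eq s_def[symmetric]\<close>)
  show ?thesis
  proof (cases "s < 1 / 2")
    case True
    have "s / \<beta> < 2 - s" using quad ab by (simp add: field_simps)
    then show ?thesis using True by (intro main[of 2]) simp_all
  next
    case False
    \<comment> \<open>The perimeter condition solved for \<open>T\<close> is
      \<open>T < 4 * s / (4 * s - 1)\<close>, and the cost condition is
      \<open>(s / \<beta> - s) / (1 - s) < T\<close>.\<close>
    have "1 < 4 * s / (4 * s - 1)" using False by (simp add: field_simps)
    moreover have "(s / \<beta> - s) / (1 - s) < 4 * s / (4 * s - 1)"
    proof -
      have "4 * s - 1 < 3 * \<beta>" using lin by (simp add: s_def field_simps)
      then have "(1 - \<beta>) * (4 * s - 1) < 4 * (\<beta> * (1 - s))" by (simp add: algebra_simps)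
      then have "(1 - \<beta>) / (\<beta> * (1 - s)) < 4 / (4 * s - 1)"
        using False ab s by (simp add: divide_simps mult.commute)
      then have "s * ((1 - \<beta>) / (\<beta> * (1 - s))) < s * (4 / (4 * s - 1))"
        using s by (intro mult_strict_left_mono)
      moreover have "(s / \<beta> - s) / (1 - s) = s * ((1 - \<beta>) / (\<beta> * (1 - s)))"
        using ab s by (simp add: field_simps)
      ultimately show ?thesis by (simp add: mult.commute)
    qed
    ultimately obtain T where T: "1 < T" "(s / \<beta> - s) / (1 - s) < T" "T < 4 * s / (4 * s - 1)"
      using dense[of "max 1 ((s / \<beta> - s) / (1 - s))" "4 * s / (4 * s - 1)"] by auto
    have "s / \<beta> - s < T * (1 - s)" using T(2) s by (simp add: pos_divide_less_eq)
    moreover have up: "T * (4 * s - 1) < 4 * s" using T(3) False by (simp add: pos_less_divide_eq)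
    moreover have "4 * s / (4 * s - 1) \<le> 2" using False by (simp add: field_simps)
    ultimately show ?thesis using T
      by (intro main[of T]) (simp_all add: algebra_simps)
  qed
qed

text \<open>With \<open>d\<close> the largest integer below \<open>1 / (1 - \<omega>)\<close>,
  almost all pairs are at distance more than \<open>d\<close>, so \<open>T = d + 1\<close> and
  \<open>c = 1\<close> apply. The cost condition becomes
  \<open>\<alpha> < (2 * d + 1) * \<beta>\<close>.\<close>

lemma case_fractional:
  fixes \<alpha> \<beta> \<omega> :: real
  assumes ab: "\<alpha> > \<beta>" "\<beta> > 0" and om: "0 < \<omega>" "\<omega> < 1"
    and cond: "\<beta> > 1 / (2 * real_of_int \<lceil>1 / (1 - \<omega>)\<rceil> - 1) * \<alpha>"
  shows "whp \<alpha> \<beta> \<omega> (\<lambda>n P E. \<not> lp_recovers n P E)"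
proof -
  define x where "x = 1 / (1 - \<omega>)"
  define d where "d = nat (\<lceil>x\<rceil> - 1)"
  have x: "1 < x" using om by (simp add: x_def)
  then have d: "1 \<le> d" "real d = real_of_int \<lceil>x\<rceil> - 1" by (auto simp: d_def) linarith
  have "real d < x" using d(2) ceiling_correct[of x] by linarith
  then have lt: "real d * (1 - \<omega>) < 1" using om by (simp add: x_def field_simps)
  have "\<alpha> < (2 * (real d + 1) - 1) * \<beta>"
    using cond d by (simp add: x_def[symmetric] field_simps)
  then have "(\<alpha> + \<beta>) / (2 * \<beta>) < real d + 1" using ab by (simp add: field_simps)
  then show ?thesis using lt d x
    by (intro whp_not_recovers_sparse[OF ab om, where d = d and T = "real d + 1" and c = 1]) auto
qed

text \<open>Distance \<open>2\<close> is critical. The second member of the maximum gives the cost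
  condition at \<open>T = 3\<close>. The first member serves when \<open>e \<le> 1 / 4\<close>,
  where the perimeter condition excludes \<open>T = 3\<close>.\<close>

lemma case_half:
  fixes \<alpha> \<beta> :: real
  assumes ab: "\<alpha> > \<beta>" "\<beta> > 0"
    and cond: "\<beta> > max ((1 - 2 * exp (- (\<alpha>\<^sup>2))) / (2 - exp (- (\<alpha>\<^sup>2)))) (1 / (3 + 2 * exp (- (\<alpha>\<^sup>2)))) * \<alpha>"
  shows "whp \<alpha> \<beta> (1 / 2) (\<lambda>n P E. \<not> lp_recovers n P E)"
proof -
  define e where "e = exp (- (\<alpha>\<^sup>2))"
  have e: "0 < e" "e \<le> 1" by (auto simp: e_def)
  have "(1 - 2 * e) / (2 - e) * \<alpha> \<le> max ((1 - 2 * e) / (2 - e)) (1 / (3 + 2 * e)) * \<alpha>"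
    "1 / (3 + 2 * e) * \<alpha> \<le> max ((1 - 2 * e) / (2 - e)) (1 / (3 + 2 * e)) * \<alpha>"
    using ab by (intro mult_right_mono; simp)+
  then have c1: "(1 - 2 * e) / (2 - e) * \<alpha> < \<beta>" and c2: "1 / (3 + 2 * e) * \<alpha> < \<beta>"
    using cond unfolding e_def[symmetric] by linarith+
  have c2': "\<alpha> < (3 + 2 * e) * \<beta>" using c2 e by (simp add: field_simps)
  have c1': "(1 - 2 * e) * \<alpha> < (2 - e) * \<beta>" using c1 e by (simp add: pos_divide_less_eq mult.commute)
  have main: ?thesis if T: "2 \<le> T" "T \<le> 3" "3 * T / 4 < 2 + (T - 2) * e" "(\<alpha> + \<beta>) / (2 * \<beta>) < 2 + (T - 2) * e" for T
    by (rule whp_not_recovers_sparse[OF ab, where d = 2 and T = T and c = e])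
       (use T in \<open>simp_all add: e_def\<close>)
  show ?thesis
  proof (cases "1 / 4 < e")
    case True
    have "(\<alpha> + \<beta>) / (2 * \<beta>) < 2 + e" using c2' ab by (simp add: field_simps)
    then show ?thesis using True by (intro main[of 3]) auto
  next
    case False
    \<comment> \<open>The perimeter condition solved for \<open>T\<close> is
      \<open>T < ?M\<close>.\<close>
    let ?M = "8 * (1 - e) / (3 - 4 * e)"
    have M: "2 < ?M" "?M \<le> 3" using False by (simp_all add: field_simps)
    have "((\<alpha> + \<beta>) / (2 * \<beta>) - 2 * (1 - e)) / e < ?M"
    proof -
      have "(\<alpha> + \<beta>) * (2 * (1 - 2 * e)) < 3 * (1 - e) * (2 * \<beta>)" using c1' by (simp add: algebra_simps)
      then have "(\<alpha> + \<beta>) / (2 * \<beta>) < 3 * (1 - e) / (2 * (1 - 2 * e))"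
        using ab False by (simp add: pos_divide_less_eq pos_less_divide_eq)
      \<comment> \<open>Amounts to \<open>4 * e \<le> 1\<close>. The right-hand side is the cost
        bound \<open>2 * (1 - e) + T * e\<close> at \<open>T = ?M\<close>.\<close>
      also have "\<dots> \<le> 6 * (1 - e) / (3 - 4 * e)"
      proof -
        have "3 * (1 - e) * (3 - 4 * e) \<le> 3 * (1 - e) * (2 * (2 * (1 - 2 * e)))"
          using False by (intro mult_left_mono) auto
        also have "\<dots> = 6 * (1 - e) * (2 * (1 - 2 * e))" by algebra
        finally show ?thesis using False by (simp add: pos_divide_le_eq pos_le_divide_eq)
      qed
      also have "\<dots> = 2 * (1 - e) + ?M * e" using False by (simp add: field_simps)
      finally show ?thesis using e by (simp add: pos_divide_less_eq)
    qed
    with M obtain T where T: "2 < T" "((\<alpha> + \<beta>) / (2 * \<beta>) - 2 * (1 - e)) / e < T" "T < ?M"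
      using dense[of "max 2 (((\<alpha> + \<beta>) / (2 * \<beta>) - 2 * (1 - e)) / e)" ?M] by auto
    have "(\<alpha> + \<beta>) / (2 * \<beta>) - 2 * (1 - e) < T * e" using T(2) e by (simp add: pos_divide_less_eq)
    moreover have "T * (3 - 4 * e) < 8 * (1 - e)" using T(3) False by (simp add: pos_less_divide_eq)
    ultimately show ?thesis using T M
      by (intro main[of T]) (simp_all add: algebra_simps)
  qed
qed

text \<open>Distance \<open>d = 1 / (1 - \<omega>)\<close> is critical, so \<open>T = d + 1\<close>
  gives the lower bound \<open>d + e\<close> for the average truncated distance, and the hypothesis
  on \<beta> is the cost condition.\<close>

lemma case_integral:
  fixes \<alpha> \<beta> \<omega> :: real
  assumes ab: "\<alpha> > \<beta>" "\<beta> > 0" and om: "0 < \<omega>" "\<omega> < 1" and int: "1 / (1 - \<omega>) \<in> \<nat> - {2}"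
    and cond: "\<beta> > 1 / (2 * (1 / (1 - \<omega>)) - 1 + 2 * exp (- (\<alpha> powr (1 / (1 - \<omega>))))) * \<alpha>"
  shows "whp \<alpha> \<beta> \<omega> (\<lambda>n P E. \<not> lp_recovers n P E)"
proof -
  from int obtain d :: nat where d: "1 / (1 - \<omega>) = real d" "d \<noteq> 2" by (auto simp: Nats_def)
  have "1 < real d" using om by (simp flip: d(1))
  \<comment> \<open>For \<open>3 \<le> d\<close> the perimeter condition at
    \<open>T = d + 1\<close>, which reads \<open>3 < d + 4 * e\<close>, holds for every positive
    \<open>e\<close>.\<close>
  then have d3: "3 \<le> d" using d(2) by simp
  have d1: "real d * (1 - \<omega>) = 1" using d(1) om by (simp add: field_simps)
  define e where "e = exp (- (\<alpha> ^ d))"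
  have e: "0 < e" by (simp add: e_def)
  have "1 / (2 * real d - 1 + 2 * e) * \<alpha> < \<beta>"
    using cond ab by (simp add: d(1) powr_realpow e_def)
  then have "\<alpha> < (2 * real d - 1 + 2 * e) * \<beta>" using d3 e by (simp add: field_simps)
  then have cost: "(\<alpha> + \<beta>) / (2 * \<beta>) < real d + e" using ab by (simp add: field_simps)
  have "e = (if real d * (1 - \<omega>) = 1 then exp (- (\<alpha> ^ d)) else 1)"
    by (simp add: d1 e_def)
  then show ?thesis
    by (rule whp_not_recovers_sparse[OF ab om _ _ _ _ _ _ _, where T = "real d + 1", rotated 4])
       (use d3 d1 e cost in auto)
qed

theorem theorem7:
  fixes \<alpha> \<beta> \<omega> :: real
  assumes "\<alpha> > \<beta>" and "\<beta> > 0" and "0 \<le> \<omega>" and "\<omega> < 1"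
    and "\<omega> = 0 \<Longrightarrow> \<alpha> \<in> {0<..<1} \<and> \<beta> \<in> {0<..<1}"
    and "(\<omega> = 0 \<and>
            \<beta> > max ((3 - \<alpha> - sqrt ((3 - \<alpha>)\<^sup>2 - 4 * \<alpha>)) / 2) (2 * \<alpha> - 1))
       \<or> (\<omega> \<in> {0<..<1} \<and> 1 / (1 - \<omega>) \<notin> \<nat> \<and>
            \<beta> > 1 / (2 * real_of_int \<lceil>1 / (1 - \<omega>)\<rceil> - 1) * \<alpha>)
       \<or> (\<omega> = 1 / 2 \<and>
            \<beta> > max ((1 - 2 * exp (- (\<alpha>\<^sup>2))) / (2 - exp (- (\<alpha>\<^sup>2))))
                     (1 / (3 + 2 * exp (- (\<alpha>\<^sup>2)))) * \<alpha>)
       \<or> (\<omega> \<in> {0<..<1} \<and> 1 / (1 - \<omega>) \<in> \<nat> - {2} \<and>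
            \<beta> > 1 / (2 * (1 / (1 - \<omega>)) - 1 + 2 * exp (- (\<alpha> powr (1 / (1 - \<omega>))))) * \<alpha>)"
  shows "((\<lambda>n. measure_pmf.prob
              (sbm n (\<alpha> * real n powr (- \<omega>)) (\<beta> * real n powr (- \<omega>)))
              {(P, E). \<not> lp_recovers n P E}) \<longlongrightarrow> 1)
           (inf sequentially (principal {n. even n}))"
proof (rule whp_sbm)
  show "whp \<alpha> \<beta> \<omega> (\<lambda>n P E. \<not> lp_recovers n P E)"
    using assms(6)
  proof (elim disjE conjE)
    assume "\<omega> = 0" "\<beta> > max ((3 - \<alpha> - sqrt ((3 - \<alpha>)\<^sup>2 - 4 * \<alpha>)) / 2) (2 * \<alpha> - 1)"
    then show ?thesis using assms(1,2,5) by (simp add: case_dense)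
  next
    assume "\<omega> \<in> {0<..<1}" "\<beta> > 1 / (2 * real_of_int \<lceil>1 / (1 - \<omega>)\<rceil> - 1) * \<alpha>"
    then show ?thesis by (intro case_fractional assms(1,2)) auto
  next
    assume om: "\<omega> = 1 / 2" and "\<beta> > max ((1 - 2 * exp (- (\<alpha>\<^sup>2))) / (2 - exp (- (\<alpha>\<^sup>2))))
                     (1 / (3 + 2 * exp (- (\<alpha>\<^sup>2)))) * \<alpha>"
    then show ?thesis unfolding om by (intro case_half assms(1,2))
  next
    assume "\<omega> \<in> {0<..<1}" "1 / (1 - \<omega>) \<in> \<nat> - {2}"
      "\<beta> > 1 / (2 * (1 / (1 - \<omega>)) - 1 + 2 * exp (- (\<alpha> powr (1 / (1 - \<omega>))))) * \<alpha>"
    then show ?thesis by (intro case_integral assms(1,2)) auto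
  qed
qed

end
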